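(* Let $r>0$, $\alpha\in\,]1,\infty[$, $c>0$, $a>0$ and $b\in\mathbb R$. If $$b_\mu(s)\sim c\,(1/s)^{a}(\log(1/s))^{b}\quad\text{as }s\to0,$$ then $$D_{\mu,r}^{\alpha}(R)\sim\left(c^{1/a}a^{-b/a}\left(\frac{\alpha-1}{\alpha}R\right)^{-1/a}\left(\log\left(\frac{\alpha-1}{\alpha}R\right)\right)^{b/a}\right)^{r}e^{-\frac{\alpha-1}{\alpha}R}\quad\text{as }R\to\infty.$$
   Context: Standing assumptions: $(E,\|\cdot\|)$ is a real separable Banach space of infinite dimension; $\mu$ is a non-atomic centered Gaussian Borel probability measure on $E$ whose support is all of $E$ (so all moments $\int\|x\|^r d\mu(x)$ are finite). For $a\in E$, $s>0$, $B(a,s)=\{x\in E:\|x-a\|\le s\}$ is the closed ball. The small ball function is $b_\mu(s)=-\log\mu(B(0,s))$, $s>0$ (natural logarithm). A quantizer is a Borel-measurable map $f:E\to E$ whose image $f(E)$ is countable (finite or countably infinite); $\mathcal F$ is the set of all quantizers. For $\alpha\in\,]1,\infty[$ the R\'enyi-$\alpha$-entropy of $f$ with respect to $\mu$ is $$H_\mu^\alpha(f)=\frac{1}{1-\alpha}\log\Big(\sum_{z\in f(E)}\mu(f^{-1}(z))^{\alpha}\Big).$$ Put $D_{\mu,r}(f)=\int_E\|x-f(x)\|^r\,d\mu(x)$, and for $R\ge0$, $$D_{\mu,r}^{\alpha}(R)=\inf\{D_{\mu,r}(f): f\in\mathcal F,\ H_\mu^\alpha(f)\le R\}.$$ Notation: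 $f\sim g$ as $x\to x_*$ means $\lim_{x\to x_*}f(x)/g(x)=1$. *)

theory Defs
  imports "HOL-Probability.Probability" "HOL-Library.Landau_Symbols"
begin

text \<open>Degenerate one-dimensional marginals (point mass at 0) count as Gaussian.\<close>

definition centered_gaussian_real :: "real measure \<Rightarrow> bool" where
  "centered_gaussian_real N \<longleftrightarrow>
     N = return borel 0 \<or>
     (\<exists>\<sigma>>0. N = density lborel (\<lambda>x. ennreal (normal_density 0 \<sigma> x)))"

definition centered_gaussian :: "'a::real_normed_vector measure \<Rightarrow> bool" where
  "centered_gaussian M \<longleftrightarrow>
     prob_space M \<and> sets M = sets borel \<and>
     (\<forall>\<phi>::'a \<Rightarrow> real. bounded_linear \<phi> \<longrightarrow> centered_gaussian_real (distr M borel \<phi>))"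

definition non_atomic :: "'a measure \<Rightarrow> bool" where
  "non_atomic M \<longleftrightarrow>
     (\<forall>A\<in>sets M. 0 < emeasure M A \<longrightarrow>
        (\<exists>B\<in>sets M. B \<subseteq> A \<and> 0 < emeasure M B \<and> emeasure M B < emeasure M A))"

definition measure_support :: "'a::topological_space measure \<Rightarrow> 'a set" where
  "measure_support M = {x. \<forall>U. open U \<longrightarrow> x \<in> U \<longrightarrow> 0 < emeasure M U}"

definition small_ball_fun :: "'a::real_normed_vector measure \<Rightarrow> real \<Rightarrow> real" where
  "small_ball_fun M s = - ln (measure M (cball 0 s))"

definition quantizers :: "('a::topological_space \<Rightarrow> 'a) set" where
  "quantizers = {f. f \<in> borel \<rightarrow>\<^sub>M borel \<and> countable (range f)}"

text \<open>For \<open>\<alpha> > 1\<close> the sum converges (its terms are bounded by the cell masses) and is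
  positive, so \<open>infsum\<close> and \<open>ln\<close> never take their default values.\<close>

definition renyi_entropy :: "'a measure \<Rightarrow> real \<Rightarrow> ('a \<Rightarrow> 'a) \<Rightarrow> real" where
  "renyi_entropy M \<alpha> f =
     1 / (1 - \<alpha>) * ln (\<Sum>\<^sub>\<infinity>z\<in>range f. measure M (f -` {z}) powr \<alpha>)"

text \<open>Quantizers may have infinite distortion. The integral and the infimum are therefore taken
  in \<^typ>\<open>ennreal\<close>: the Bochner integral would assign such quantizers the value 0.\<close>

definition distortion :: "'a::real_normed_vector measure \<Rightarrow> real \<Rightarrow> ('a \<Rightarrow> 'a) \<Rightarrow> ennreal" where
  "distortion M r f = (\<integral>\<^sup>+ x. ennreal (norm (x - f x) powr r) \<partial>M)"

text \<open>The infimum is finite for \<open>R \<ge> 0\<close> and Gaussian \<open>M\<close>: the constant quantizer 0 has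
  entropy 0, and all moments of a Gaussian measure are finite.\<close>

definition optimal_distortion ::
    "'a::real_normed_vector measure \<Rightarrow> real \<Rightarrow> real \<Rightarrow> real \<Rightarrow> real" where
  "optimal_distortion M r \<alpha> R =
     enn2real (INF f\<in>{f \<in> quantizers. renyi_entropy M \<alpha> f \<le> R}. distortion M r f)"

end

theory Submission
  imports Defs "HOL-Real_Asymp.Real_Asymp"
begin

text \<open>Put \<open>\<rho> = (\<alpha> - 1) / \<alpha> * R\<close>. Since \<open>\<alpha> > 1\<close>, the entropy constraint says that the \<open>\<alpha>\<close>-th powers
  of the cell masses sum to at least \<open>exp(-\<alpha> \<rho>)\<close>, and a single cell of mass \<open>exp(-\<rho>)\<close> already
  achieves this. Placing that cell in the ball of mass \<open>exp(-\<rho>)\<close> around the origin and quantizing its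
  complement arbitrarily finely costs at most \<open>s\<^sup>r exp(-\<rho>)\<close>, where \<open>s\<close> is the radius of the ball.

  Conversely, by Anderson's inequality a cell of mass \<open>p = exp(-x)\<close> costs asymptotically at least
  \<open>p \<tau>(x)\<^sup>r\<close>, where \<open>\<tau>\<close> inverts the small ball function. As \<open>\<tau>\<close> varies regularly,
  \<open>\<tau>(x)\<^sup>r exp((\<alpha> - 1) x)\<close> increases eventually, so a cell of mass below \<open>exp(-\<rho>)\<close> costs at least
  \<open>p\<^sup>\<alpha> exp((\<alpha> - 1) \<rho>) \<tau>(\<rho>)\<^sup>r\<close>, and these bounds add up to \<open>\<tau>(\<rho>)\<^sup>r exp(-\<rho>)\<close>.

  Anderson's inequality is reduced to finitely many functionals by writing a ball as an intersection of
  slabs; the functionals are linear images of a standard normal vector, whose law satisfies the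
  Prekopa-Leindler inequality, and translates of a symmetric slab by \<open>c\<close> and \<open>-c\<close> have equal mass.\<close>

section \<open>Norming functionals\<close>

definition sublinear :: "('a::real_normed_vector \<Rightarrow> real) \<Rightarrow> bool" where
  "sublinear p \<longleftrightarrow> (\<forall>x y. p (x + y) \<le> p x + p y) \<and> (\<forall>x. \<forall>c>0. p (c *\<^sub>R x) = c * p x)"

lemma sublinear_add: "sublinear p \<Longrightarrow> p (x + y) \<le> p x + p y"
  by (simp add: sublinear_def)

lemma sublinear_scale: "sublinear p \<Longrightarrow> c > 0 \<Longrightarrow> p (c *\<^sub>R x) = c * p x"
  by (simp add: sublinear_def)

lemma sublinear_zero: "sublinear p \<Longrightarrow> p 0 = 0"
  using sublinear_scale[of p 2 0] by simp

lemma sublinear_minus: "sublinear p \<Longrightarrow> - p (- x) \<le> p x"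
  using sublinear_add[of p x "- x"] by (simp add: sublinear_zero)

lemma sublinear_norm: "sublinear norm"
  by (auto simp: sublinear_def norm_triangle_ineq)

text \<open>For sublinear \<open>p\<close> this is the largest sublinear function below
  \<open>p\<close> whose value at \<open>- y\<close> is at most \<open>- p y\<close>.\<close>

definition tilt :: "('a::real_normed_vector \<Rightarrow> real) \<Rightarrow> 'a \<Rightarrow> 'a \<Rightarrow> real" where
  "tilt p y x = (INF t\<in>{0<..}. p (x + t *\<^sub>R y) - t * p y)"

lemma tilt_bdd:
  assumes "sublinear p"
  shows "bdd_below ((\<lambda>t. p (x + t *\<^sub>R y) - t * p y) ` {0<..})"
proof (rule bdd_belowI2)
  fix t :: real assume t: "t \<in> {0<..}"
  have "p (t *\<^sub>R y) \<le> p (x + t *\<^sub>R y) + p (- x)"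
    using sublinear_add[OF assms, of "x + t *\<^sub>R y" "- x"] by simp
  then show "- p (- x) \<le> p (x + t *\<^sub>R y) - t * p y"
    using t by (simp add: sublinear_scale[OF assms])
qed

lemma tilt_le:
  assumes "sublinear p" "t > 0"
  shows "tilt p y x \<le> p (x + t *\<^sub>R y) - t * p y"
  unfolding tilt_def using tilt_bdd[OF assms(1)] assms(2) by (intro cINF_lower) auto

lemma tilt_le_self:
  assumes "sublinear p"
  shows "tilt p y x \<le> p x"
  using tilt_le[OF assms, of 1 y x] sublinear_add[OF assms, of x y] by simp

lemma tilt_minus_le:
  assumes "sublinear p"
  shows "tilt p y (- y) \<le> - p y"
  using tilt_le[OF assms, of 1 y "- y"] by (simp add: sublinear_zero[OF assms])

lemma sublinear_tilt:
  assumes "sublinear p"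
  shows "sublinear (tilt p y)"
  unfolding sublinear_def
proof (intro conjI allI impI)
  fix x z
  have *: "tilt p y (x + z) - (p (z + t *\<^sub>R y) - t * p y) \<le> p (x + s *\<^sub>R y) - s * p y"
    if "s > 0" "t > 0" for s t
    using tilt_le[OF assms, of "s + t" y "x + z"]
      sublinear_add[OF assms, of "x + s *\<^sub>R y" "z + t *\<^sub>R y"] that
    by (simp add: algebra_simps)
  have "tilt p y (x + z) - (p (z + t *\<^sub>R y) - t * p y) \<le> tilt p y x" if "t > 0" for t
    using *[OF _ that] unfolding tilt_def[of p y x] by (intro cINF_greatest) auto
  then have "tilt p y (x + z) - tilt p y x \<le> p (z + t *\<^sub>R y) - t * p y" if "t > 0" for t
    using that by fastforce
  then have "tilt p y (x + z) - tilt p y x \<le> tilt p y z"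
    unfolding tilt_def[of p y z] by (intro cINF_greatest) auto
  then show "tilt p y (x + z) \<le> tilt p y x + tilt p y z" by simp
next
  have le: "tilt p y (c *\<^sub>R x) \<le> c * tilt p y x" if "c > 0" for c x
  proof -
    have "tilt p y (c *\<^sub>R x) / c \<le> p (x + t *\<^sub>R y) - t * p y" if "t > 0" for t
    proof -
      have "tilt p y (c *\<^sub>R x) \<le> p (c *\<^sub>R (x + t *\<^sub>R y)) - c * t * p y"
        using tilt_le[OF assms, of "c * t" y "c *\<^sub>R x"] \<open>c > 0\<close> that by (simp add: algebra_simps)
      also have "\<dots> = c * (p (x + t *\<^sub>R y) - t * p y)"
        using \<open>c > 0\<close> by (simp only: sublinear_scale[OF assms]) (simp add: algebra_simps)
      finally show ?thesis using \<open>c > 0\<close> by (simp add: field_simps)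
    qed
    then have "tilt p y (c *\<^sub>R x) / c \<le> tilt p y x"
      unfolding tilt_def[of p y x] by (intro cINF_greatest) auto
    then show ?thesis using that by (simp add: field_simps)
  qed
  fix x and c :: real assume c: "c > 0"
  show "tilt p y (c *\<^sub>R x) = c * tilt p y x"
    using le[OF c, of x] le[of "inverse c" "c *\<^sub>R x"] c by (simp add: field_simps)
qed

text \<open>Zorn's lemma applies because the pointwise infimum of a chain is again sublinear; it is
  finite since every sublinear \<open>q \<le> p\<close> satisfies
  \<open>q x \<ge> - p (- x)\<close>.\<close>

lemma exists_minimal_sublinear:
  assumes "sublinear (p :: 'a::real_normed_vector \<Rightarrow> real)"
  obtains m where "sublinear m" "m \<le> p" "\<And>q. sublinear q \<Longrightarrow> q \<le> m \<Longrightarrow> q = m"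
proof -
  define A where "A = {q. sublinear q \<and> q \<le> p}"
  \<comment> \<open>The order is reversed, so that a maximal element in the sense of Zorn is a
    minimal functional.\<close>
  define P where "P = (\<lambda>q r :: 'a \<Rightarrow> real. r \<le> q)"
  have po: "partial_order_on A (relation_of P A)"
    unfolding P_def by (auto simp: partial_order_on_def preorder_on_def refl_on_def trans_def
        antisym_def relation_of_def)
  have "\<exists>m\<in>A. \<forall>a\<in>A. P m a \<longrightarrow> a = m"
  proof (rule predicate_Zorn[OF po])
    fix C assume C: "C \<in> Chains (relation_of P A)"
    have CA: "C \<subseteq> A" using C by (auto simp: Chains_def relation_of_def)
    have chain: "q \<le> r \<or> r \<le> q" if "q \<in> C" "r \<in> C" for q r
      using C that by (auto simp: Chains_def relation_of_def P_def)
    show "\<exists>u\<in>A. \<forall>a\<in>C. P a u"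
    proof (cases "C = {}")
      case True
      then show ?thesis using assms by (auto simp: A_def)
    next
      case False
      define u where "u x = (INF q\<in>C. q x)" for x
      have bdd: "bdd_below ((\<lambda>q. q x) ` C)" for x
      proof (rule bdd_belowI2)
        fix q assume "q \<in> C"
        then have q: "sublinear q" "q \<le> p" using CA by (auto simp: A_def)
        show "- p (- x) \<le> q x" using sublinear_minus[OF q(1), of x] q(2)
          by (auto simp: le_fun_def intro: order_trans[OF le_imp_neg_le])
      qed
      have le: "u x \<le> q x" if "q \<in> C" for q x
        unfolding u_def using bdd that by (intro cINF_lower) auto
      have sub: "sublinear q" if "q \<in> C" for q using CA that by (auto simp: A_def)
      have "sublinear u"
        unfolding sublinear_def
      proof (intro conjI allI impI)
        fix x y
        \<comment> \<open>The smaller of \<open>q\<close> and \<open>r\<close> is used at both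
          \<open>x\<close> and \<open>y\<close>; this is where comparability within the chain
          enters.\<close>
        have *: "u (x + y) - r y \<le> q x" if "q \<in> C" "r \<in> C" for q r
          using chain[OF that]
        proof
          assume "q \<le> r"
          then have "q y \<le> r y" by (simp add: le_fun_def)
          then show ?thesis
            using le[OF that(1), of "x + y"] sublinear_add[OF sub[OF that(1)], of x y] by simp
        next
          assume "r \<le> q"
          then have "r x \<le> q x" by (simp add: le_fun_def)
          then show ?thesis
            using le[OF that(2), of "x + y"] sublinear_add[OF sub[OF that(2)], of x y] by simp
        qed
        have "u (x + y) - r y \<le> u x" if "r \<in> C" for r
          unfolding u_def[of x] using False *[OF _ that] by (intro cINF_greatest) auto
        then have "u (x + y) - u x \<le> r y" if "r \<in> C" for r
          using that by fastforce
        then have "u (x + y) - u x \<le> u y"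
          unfolding u_def[of y] using False by (intro cINF_greatest) auto
        then show "u (x + y) \<le> u x + u y" by simp
      next
        have le': "u (c *\<^sub>R x) \<le> c * u x" if "c > 0" for c x
        proof -
          have "u (c *\<^sub>R x) / c \<le> q x" if "q \<in> C" for q
            using le[OF that, of "c *\<^sub>R x"] \<open>c > 0\<close>
            by (simp add: sublinear_scale[OF sub[OF that]] field_simps)
          then have "u (c *\<^sub>R x) / c \<le> u x"
            unfolding u_def[of x] using False by (intro cINF_greatest) auto
          then show ?thesis using that by (simp add: field_simps)
        qed
        fix x and c :: real assume c: "c > 0"
        show "u (c *\<^sub>R x) = c * u x"
          using le'[OF c, of x] le'[of "inverse c" "c *\<^sub>R x"] c by (simp add: field_simps)
      qed
      moreover have "u \<le> p"
      proof (rule le_funI)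
        fix x
        obtain q where "q \<in> C" using False by blast
        then show "u x \<le> p x" using le[of q x] CA by (auto simp: A_def le_fun_def intro: order_trans)
      qed
      ultimately show ?thesis using le by (auto simp: A_def P_def le_fun_def)
    qed
  qed
  then obtain m where "m \<in> A" "\<forall>a\<in>A. P m a \<longrightarrow> a = m" by blast
  then show ?thesis
    using that[of m] unfolding A_def P_def by (blast intro: order_trans)
qed

text \<open>Hahn-Banach: a minimal sublinear functional is linear, since tilting cannot lower it.\<close>

lemma exists_norming_functional:
  fixes x0 :: "'a::real_normed_vector"
  obtains \<phi> :: "'a \<Rightarrow> real" where "bounded_linear \<phi>" "\<And>x. \<bar>\<phi> x\<bar> \<le> norm x" "\<phi> x0 = norm x0"
proof -
  \<comment> \<open>Tilting the norm at \<open>x0\<close> before minimising forces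
    \<open>m (- x0) \<le> - norm x0\<close>; once \<open>m\<close> is odd and below the norm, this
    is the norming property.\<close>
  obtain m :: "'a \<Rightarrow> real" where m: "sublinear m" "m \<le> tilt norm x0"
    and min: "\<And>q. sublinear q \<Longrightarrow> q \<le> m \<Longrightarrow> q = m"
    using exists_minimal_sublinear[OF sublinear_tilt[OF sublinear_norm]] by blast
  have m_norm: "m x \<le> norm x" for x
    using m(2) tilt_le_self[OF sublinear_norm, of x0 x] by (auto simp: le_fun_def intro: order_trans)
  have odd: "m (- y) = - m y" for y
  proof -
    have "tilt m y = m"
      by (rule min) (auto simp: le_fun_def sublinear_tilt[OF m(1)] tilt_le_self[OF m(1)])
    then have "m (- y) \<le> - m y" using tilt_minus_le[OF m(1), of y] by simp
    with sublinear_minus[OF m(1), of y] show ?thesis by simp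
  qed
  have add: "m (x + y) = m x + m y" for x y
    using sublinear_add[OF m(1), of x y] sublinear_add[OF m(1), of "x + y" "- y"] odd[of y] by simp
  have scale: "m (c *\<^sub>R x) = c * m x" for c x
  proof -
    consider "c > 0" | "c = 0" | "- c > 0" by linarith
    then show ?thesis
    proof cases
      case 3
      then show ?thesis
        using sublinear_scale[OF m(1) 3, of x] odd[of "c *\<^sub>R x"] by simp
    qed (auto simp: sublinear_scale[OF m(1)] sublinear_zero[OF m(1)])
  qed
  have abs: "\<bar>m x\<bar> \<le> norm x" for x
    using m_norm[of x] m_norm[of "- x"] odd[of x] by simp
  have "bounded_linear m"
    by (rule bounded_linear_intro[where K = 1]) (auto simp: add scale abs)
  moreover have "m x0 = norm x0"
  proof -
    have "m (- x0) \<le> - norm x0"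
      using m(2) tilt_minus_le[OF sublinear_norm, of x0] by (auto simp: le_fun_def intro: order_trans)
    then show ?thesis using odd[of x0] m_norm[of x0] by simp
  qed
  ultimately show ?thesis using that abs by blast
qed

text \<open>Functionals norming the points of a countable dense set suffice: they are 1-Lipschitz,
  so a nearby point of the set transfers its norm to \<open>x\<close> up to twice the distance.
  Closed balls thereby become countable intersections of slabs.\<close>

lemma exists_norming_sequence:
  obtains \<phi> :: "nat \<Rightarrow> 'a::{real_normed_vector, second_countable_topology} \<Rightarrow> real"
  where "\<And>n. bounded_linear (\<phi> n)" "\<And>x t. norm x \<le> t \<longleftrightarrow> (\<forall>n. \<bar>\<phi> n x\<bar> \<le> t)"
proof -
  obtain D :: "'a set" where D: "countable D" "\<And>X. open X \<Longrightarrow> X \<noteq> {} \<Longrightarrow> \<exists>d\<in>D. d \<in> X"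
    using countable_dense_setE by blast
  have "D \<noteq> {}" using D(2)[of UNIV] by auto
  define d where "d = from_nat_into D"
  have "\<exists>f. bounded_linear f \<and> (\<forall>x. \<bar>f x\<bar> \<le> norm x) \<and> f (d n) = norm (d n)" for n
    using exists_norming_functional[of "d n"] by metis
  then obtain \<phi> where \<phi>: "\<And>n. bounded_linear (\<phi> n)" "\<And>n x. \<bar>\<phi> n x\<bar> \<le> norm x"
      "\<And>n. \<phi> n (d n) = norm (d n)" by metis
  have "norm x \<le> t" if le: "\<And>n. \<bar>\<phi> n x\<bar> \<le> t" for x t
  proof (rule field_le_epsilon)
    fix e :: real assume "e > 0"
    then obtain y where "y \<in> D" "y \<in> ball x (e / 2)" using D(2)[of "ball x (e / 2)"] by auto
    then obtain n where n: "dist x (d n) < e / 2"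
      using from_nat_into_surj[OF D(1)] unfolding d_def by fastforce
    interpret bounded_linear "\<phi> n" by (rule \<phi>)
    have "norm (d n) = \<phi> n x - \<phi> n (x - d n)" using \<phi>(3)[of n] by (simp add: diff)
    also have "\<dots> \<le> t + norm (x - d n)" using le[of n] \<phi>(2)[of n "x - d n"] by simp
    finally have "norm x \<le> t + 2 * norm (x - d n)" using norm_triangle_ineq2[of x "d n"] by simp
    then show "norm x \<le> t + e" using n by (simp add: dist_norm)
  qed
  then show ?thesis using that[of \<phi>] \<phi> by (meson order_trans)
qed

section \<open>The Prekopa-Leindler inequality\<close>

text \<open>After truncation, one translate of each set lies in the midset, and the two translates
  overlap in an interval of length at most \<open>\<epsilon>\<close>.\<close>

lemma brunn_minkowski_real_bounded:
  fixes A B C :: "real set"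
  assumes [measurable]: "A \<in> sets borel" "B \<in> sets borel" "C \<in> sets borel"
    and ne: "A \<noteq> {}" "B \<noteq> {}" and bdd: "bdd_above A" "bdd_below B"
    and sub: "\<And>x y. x \<in> A \<Longrightarrow> y \<in> B \<Longrightarrow> (x + y) / 2 \<in> C"
  shows "emeasure lborel A + emeasure lborel B \<le> 2 * emeasure lborel C"
proof (rule ennreal_le_epsilon)
  fix \<epsilon> :: real assume \<epsilon>: "\<epsilon> > 0"
  obtain x where x: "x \<in> A" "Sup A - \<epsilon> / 2 < x"
    using less_cSupE[of "Sup A - \<epsilon> / 2" A] ne \<epsilon> by auto
  obtain y where y: "y \<in> B" "y < Inf B + \<epsilon> / 2"
    using cInf_lessD[of B "Inf B + \<epsilon> / 2"] ne \<epsilon> by auto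
  \<comment> \<open>\<open>X\<close> is (A + y)/2 and \<open>Y\<close> is (B + x)/2, so both lie in
    \<open>C\<close>. The choice of \<open>x\<close> near the top of \<open>A\<close> and of
    \<open>y\<close> near the bottom of \<open>B\<close> keeps their overlap short.\<close>
  define X where "X = (\<lambda>s. - y + 2 * s) -` A"
  define Y where "Y = (\<lambda>s. - x + 2 * s) -` B"
  have [measurable]: "X \<in> sets borel" "Y \<in> sets borel"
    unfolding X_def Y_def by (auto intro!: measurable_sets_borel[where M = borel])
  have A: "emeasure lborel A = 2 * emeasure lborel X"
    using nn_integral_real_affine[of "indicator A" 2 "- y"]
    by (simp add: X_def nn_integral_indicator[symmetric] indicator_def vimage_def del: nn_integral_indicator)
  have B: "emeasure lborel B = 2 * emeasure lborel Y"
    using nn_integral_real_affine[of "indicator B" 2 "- x"]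
    by (simp add: Y_def nn_integral_indicator[symmetric] indicator_def vimage_def del: nn_integral_indicator)
  have XY: "X \<union> Y \<subseteq> C"
  proof
    fix s assume "s \<in> X \<union> Y"
    then show "s \<in> C"
      using sub[of "- y + 2 * s" y] sub[of x "- x + 2 * s"] x y by (auto simp: X_def Y_def)
  qed
  have "X \<inter> Y \<subseteq> {(x + Inf B) / 2 .. (Sup A + y) / 2}"
  proof
    fix s assume "s \<in> X \<inter> Y"
    then have "- y + 2 * s \<le> Sup A" "Inf B \<le> - x + 2 * s"
      using cSup_upper[OF _ bdd(1)] cInf_lower[OF _ bdd(2)] by (auto simp: X_def Y_def)
    then show "s \<in> {(x + Inf B) / 2 .. (Sup A + y) / 2}" by auto
  qed
  then have "emeasure lborel (X \<inter> Y) \<le> emeasure lborel {(x + Inf B) / 2 .. (Sup A + y) / 2}"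
    by (intro emeasure_mono) auto
  also have "\<dots> \<le> ennreal (\<epsilon> / 2)"
    using x y \<epsilon> by (auto simp: emeasure_lborel_Icc_eq field_simps intro!: ennreal_leI)
  finally have I: "emeasure lborel (X \<inter> Y) \<le> ennreal (\<epsilon> / 2)" .
  have "emeasure lborel X + emeasure lborel Y = emeasure lborel (X \<union> Y) + emeasure lborel (X \<inter> Y)"
    by (rule emeasure_Un_Int) auto
  also have "\<dots> \<le> emeasure lborel C + ennreal (\<epsilon> / 2)"
    using XY I by (intro add_mono emeasure_mono) auto
  finally have "2 * (emeasure lborel X + emeasure lborel Y) \<le> 2 * (emeasure lborel C + ennreal (\<epsilon> / 2))"
    by (intro mult_left_mono) auto
  also have "\<dots> = 2 * emeasure lborel C + ennreal \<epsilon>"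
    using \<epsilon> ennreal_mult[of 2 "\<epsilon> / 2"] by (simp add: distrib_left)
  finally show "emeasure lborel A + emeasure lborel B \<le> 2 * emeasure lborel C + ennreal \<epsilon>"
    by (simp add: A B distrib_left)
qed

text \<open>One-sided truncations exhaust both sets, and continuity from below passes the bounded
  case to the limit. Anchoring the cuts at points \<open>a\<close> and \<open>b\<close> keeps the
  truncations nonempty.\<close>

lemma brunn_minkowski_real:
  fixes A B C :: "real set"
  assumes [measurable]: "A \<in> sets borel" "B \<in> sets borel" "C \<in> sets borel"
    and ne: "A \<noteq> {}" "B \<noteq> {}"
    and sub: "\<And>x y. x \<in> A \<Longrightarrow> y \<in> B \<Longrightarrow> (x + y) / 2 \<in> C"
  shows "emeasure lborel A + emeasure lborel B \<le> 2 * emeasure lborel C"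
proof -
  obtain a b where ab: "a \<in> A" "b \<in> B" using ne by auto
  define An where "An n = A \<inter> {..a + real n}" for n
  define Bn where "Bn n = B \<inter> {b - real n..}" for n
  have [measurable]: "An n \<in> sets borel" "Bn n \<in> sets borel" for n
    by (auto simp: An_def Bn_def)
  have le: "emeasure lborel (An n) + emeasure lborel (Bn n) \<le> 2 * emeasure lborel C" for n
  proof (rule brunn_minkowski_real_bounded)
    show "An n \<noteq> {}" "Bn n \<noteq> {}" using ab by (auto simp: An_def Bn_def)
    show "bdd_above (An n)" "bdd_below (Bn n)" unfolding An_def Bn_def by auto
  qed (use sub in \<open>auto simp: An_def Bn_def\<close>)
  have UA: "(\<Union>n. An n) = A"
  proof (intro equalityI subsetI)
    fix x assume "x \<in> A"
    moreover obtain n where "x - a \<le> real n" using real_arch_simple by blast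
    ultimately show "x \<in> (\<Union>n. An n)" by (auto simp: An_def intro!: exI[of _ n])
  qed (auto simp: An_def)
  have UB: "(\<Union>n. Bn n) = B"
  proof (intro equalityI subsetI)
    fix x assume "x \<in> B"
    moreover obtain n where "b - x \<le> real n" using real_arch_simple by blast
    ultimately show "x \<in> (\<Union>n. Bn n)" by (auto simp: Bn_def intro!: exI[of _ n])
  qed (auto simp: Bn_def)
  have "(\<lambda>n. emeasure lborel (An n)) \<longlonglongrightarrow> emeasure lborel (\<Union>n. An n)"
    by (intro Lim_emeasure_incseq) (auto simp: incseq_def An_def)
  moreover have "(\<lambda>n. emeasure lborel (Bn n)) \<longlonglongrightarrow> emeasure lborel (\<Union>n. Bn n)"
    by (intro Lim_emeasure_incseq) (auto simp: incseq_def Bn_def)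
  ultimately have "(\<lambda>n. emeasure lborel (An n) + emeasure lborel (Bn n))
      \<longlonglongrightarrow> emeasure lborel A + emeasure lborel B"
    unfolding UA UB by (intro tendsto_add) auto
  then show ?thesis by (rule LIMSEQ_le_const2) (use le in auto)
qed

text \<open>Layer-cake formula by Tonelli. Since \<open>f\<close> is bounded by 1, only levels in
  (0, 1) contribute; if the supremum is 1, each of them has a nonempty superlevel set, as the
  inequality for sets requires.\<close>

lemma nn_integral_unit_layers:
  fixes f :: "real \<Rightarrow> ennreal"
  assumes [measurable]: "f \<in> borel_measurable borel" and le: "\<And>x. f x \<le> 1"
  shows "(\<integral>\<^sup>+x. f x \<partial>lborel) = (\<integral>\<^sup>+t. emeasure lborel {x. ennreal t < f x} * indicator {0<..<1} t \<partial>lborel)"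
proof -
  have layer: "f x = (\<integral>\<^sup>+t. indicator {t. ennreal t < f x} t * indicator {0<..<1} t \<partial>lborel)" for x
  proof -
    define r where "r = enn2real (f x)"
    have r: "f x = ennreal r" "0 \<le> r" "r \<le> 1"
      using le[of x] by (auto simp: r_def ennreal_enn2real_if top_unique enn2real_leI)
    have "(\<lambda>t. indicator {t. ennreal t < f x} t * indicator {0<..<1} t) = (indicator {0<..<r} :: real \<Rightarrow> ennreal)"
      using r by (auto simp: fun_eq_iff indicator_def ennreal_less_iff)
    then show ?thesis using r by simp
  qed
  have "(\<integral>\<^sup>+x. f x \<partial>lborel)
      = (\<integral>\<^sup>+x. \<integral>\<^sup>+t. indicator {x. ennreal t < f x} x * indicator {0<..<1} t \<partial>lborel \<partial>lborel)"
    by (subst layer) (simp add: indicator_def)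
  also have "\<dots> = (\<integral>\<^sup>+t. \<integral>\<^sup>+x. indicator {x. ennreal t < f x} x * indicator {0<..<1} t \<partial>lborel \<partial>lborel)"
  proof (rule lborel_pair.Fubini')
    have "(\<lambda>(t, x). indicator {x. ennreal t < f x} x * indicator {0<..<1} t) =
        (\<lambda>p. indicator {p. ennreal (fst p) < f (snd p)} p * (indicator {0<..<1} (fst p)) :: ennreal)"
      by (auto simp: fun_eq_iff indicator_def)
    then show "(\<lambda>(t, x). indicator {x. ennreal t < f x} x * indicator {0<..<1} t :: ennreal)
        \<in> borel_measurable (lborel \<Otimes>\<^sub>M lborel)"
      unfolding indicator_def by measurable
  qed
  also have "\<dots> = (\<integral>\<^sup>+t. emeasure lborel {x. ennreal t < f x} * indicator {0<..<1} t \<partial>lborel)"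
    by (intro nn_integral_cong) (simp add: nn_integral_multc)
  finally show ?thesis .
qed

text \<open>The inequality of arithmetic and geometric means, used to turn an additive bound for
  integrals into a multiplicative one.\<close>

lemma ennreal_arith_geo_mean: "a + b \<le> 2 * c \<Longrightarrow> a * b \<le> c ^ 2" for a b c :: ennreal
proof (cases "c = \<top>")
  case False
  assume le: "a + b \<le> 2 * c"
  have "2 * c < \<top>" using False by (simp add: ennreal_mult_less_top less_top)
  then have fin: "a < \<top>" "b < \<top>" using le by (auto simp: less_top[symmetric] top_unique)
  obtain x y z where xyz: "a = ennreal x" "b = ennreal y" "c = ennreal z" "0 \<le> x" "0 \<le> y" "0 \<le> z"
    using fin False by (metis ennreal_cases less_irrefl)
  have "ennreal (x + y) \<le> ennreal (2 * z)"
    using le xyz by (simp add: ennreal_mult)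
  then have "x + y \<le> 2 * z" using xyz by (subst (asm) ennreal_le_iff) auto
  then have "(x + y) ^ 2 \<le> (2 * z) ^ 2" using xyz by (intro power_mono) auto
  then have "x * y \<le> z ^ 2" using sum_squares_bound[of x y] by (simp add: power2_sum power_mult_distrib)
  then show ?thesis using xyz by (simp add: ennreal_mult[symmetric] ennreal_power ennreal_leI)
qed simp

text \<open>After scaling \<open>f\<close> and \<open>g\<close> to supremum 1, their superlevel sets
  at each level in (0, 1) are nonempty and satisfy the Brunn-Minkowski hypothesis. Integrating over
  the levels bounds the sum of the two integrals by twice the third; the inequality of means
  follows, and the scaling is undone at the end.\<close>

lemma prekopa_leindler_real:
  fixes f g h :: "real \<Rightarrow> ennreal"
  assumes [measurable]: "f \<in> borel_measurable borel" "g \<in> borel_measurable borel" "h \<in> borel_measurable borel"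
    and bd: "\<And>x. f x \<le> 1" "\<And>x. g x \<le> 1"
    and le: "\<And>x y. f x * g y \<le> h ((x + y) / 2) ^ 2"
  shows "(\<integral>\<^sup>+x. f x \<partial>lborel) * (\<integral>\<^sup>+x. g x \<partial>lborel) \<le> (\<integral>\<^sup>+x. h x \<partial>lborel) ^ 2"
proof (cases "(SUP x. f x) = 0 \<or> (SUP x. g x) = 0")
  case True
  then have "(\<forall>x. f x = 0) \<or> (\<forall>x. g x = 0)" by (auto simp: SUP_eq_iff bot_ennreal)
  then show ?thesis by auto
next
  case False
  define F where "F = (SUP x. f x)"
  define G where "G = (SUP x. g x)"
  have "F \<le> 1" "G \<le> 1" unfolding F_def G_def using bd by (auto intro: SUP_least)
  then have "F \<noteq> \<top>" "G \<noteq> \<top>" by (auto simp: top_unique)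
  with False have F: "0 < F" "F < \<top>" and G: "0 < G" "G < \<top>"
    by (simp_all add: F_def[symmetric] G_def[symmetric] zero_less_iff_neq_zero less_top[symmetric])
  \<comment> \<open>The geometric mean of the two suprema: dividing \<open>h\<close> by it preserves
    the midpoint hypothesis.\<close>
  define H where "H = ennreal (sqrt (enn2real F * enn2real G))"
  have HH: "H ^ 2 = F * G"
    using F G by (simp add: H_def ennreal_power ennreal_mult)
  have H: "0 < H" "H < \<top>"
    using F G by (auto simp: H_def enn2real_positive_iff)
  define f' where "f' x = f x / F" for x
  define g' where "g' x = g x / G" for x
  \<comment> \<open>The cap at 1 makes the layer formula applicable and leaves the superlevel sets
    at levels below 1 unchanged.\<close>
  define h' where "h' x = min 1 (h x / H)" for x
  have [measurable]: "f' \<in> borel_measurable borel" "g' \<in> borel_measurable borel" "h' \<in> borel_measurable borel"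
    unfolding f'_def g'_def h'_def by measurable
  have f'1: "f' x \<le> 1" for x
    using SUP_upper[of x UNIV f] F unfolding f'_def F_def[symmetric]
    by (metis UNIV_I divide_right_mono_ennreal ennreal_divide_self less_irrefl)
  have g'1: "g' x \<le> 1" for x
    using SUP_upper[of x UNIV g] G unfolding g'_def G_def[symmetric]
    by (metis UNIV_I divide_right_mono_ennreal ennreal_divide_self less_irrefl)
  have h'1: "h' x \<le> 1" for x by (simp add: h'_def)
  have lvl: "\<exists>x. t < f' x" "\<exists>x. t < g' x" if "t < 1" for t
  proof -
    have "(SUP x. f' x) = 1" "(SUP x. g' x) = 1"
      unfolding f'_def g'_def using F G by (simp_all add: SUP_divide_ennreal[symmetric] F_def[symmetric] G_def[symmetric])
    then show "\<exists>x. t < f' x" "\<exists>x. t < g' x" using that less_SUP_iff[of t] by (metis UNIV_I)+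
  qed
  have key: "emeasure lborel {x. ennreal t < f' x} + emeasure lborel {x. ennreal t < g' x}
      \<le> 2 * emeasure lborel {x. ennreal t < h' x}" if t: "0 < t" "t < 1" for t
  proof (rule brunn_minkowski_real)
    show "{x. ennreal t < f' x} \<noteq> {}" "{x. ennreal t < g' x} \<noteq> {}"
      using lvl[of "ennreal t"] t by (auto simp: ennreal_less_one_iff)
    fix x y assume "x \<in> {x. ennreal t < f' x}" "y \<in> {x. ennreal t < g' x}"
    moreover obtain a b where "f' x = ennreal a" "g' y = ennreal b" "0 \<le> a" "0 \<le> b"
      using f'1[of x] g'1[of y] by (metis ennreal_cases ennreal_one_neq_top top_unique)
    ultimately have "ennreal t * ennreal t < f' x * g' y"
      using t by (auto simp: ennreal_mult[symmetric] ennreal_less_iff intro!: mult_strict_mono)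
    also have "\<dots> = f x * g y / H ^ 2"
      unfolding f'_def g'_def HH using F G
      by (simp add: divide_ennreal_def ennreal_inverse_mult ac_simps)
    also have "\<dots> \<le> h ((x + y) / 2) ^ 2 / H ^ 2"
      by (intro divide_right_mono_ennreal le)
    also have "\<dots> = (h ((x + y) / 2) / H) ^ 2"
      using H by (simp add: divide_ennreal_def ennreal_inverse_power power_mult_distrib)
    finally have "ennreal t ^ 2 < (h ((x + y) / 2) / H) ^ 2" by (simp add: power2_eq_square)
    then have "ennreal t < h ((x + y) / 2) / H"
      by (metis not_le power_mono zero_le)
    then show "(x + y) / 2 \<in> {x. ennreal t < h' x}" using t by (auto simp: h'_def ennreal_less_one_iff)
  qed measurable
  have "(\<integral>\<^sup>+x. f' x \<partial>lborel) + (\<integral>\<^sup>+x. g' x \<partial>lborel)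
      = (\<integral>\<^sup>+t. (emeasure lborel {x. ennreal t < f' x} + emeasure lborel {x. ennreal t < g' x}) * indicator {0<..<1} t \<partial>lborel)"
    using f'1 g'1 by (simp add: nn_integral_unit_layers nn_integral_add distrib_right)
  also have "\<dots> \<le> (\<integral>\<^sup>+t. 2 * (emeasure lborel {x. ennreal t < h' x} * indicator {0<..<1} t) \<partial>lborel)"
    using key by (intro nn_integral_mono) (auto simp: indicator_def)
  also have "\<dots> = 2 * (\<integral>\<^sup>+x. h' x \<partial>lborel)"
    using h'1 by (simp add: nn_integral_unit_layers nn_integral_cmult)
  finally have "(\<integral>\<^sup>+x. f' x \<partial>lborel) * (\<integral>\<^sup>+x. g' x \<partial>lborel) \<le> (\<integral>\<^sup>+x. h' x \<partial>lborel) ^ 2"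
    by (rule ennreal_arith_geo_mean)
  also have "\<dots> \<le> (\<integral>\<^sup>+x. h x / H \<partial>lborel) ^ 2"
    by (intro power_mono nn_integral_mono) (auto simp: h'_def)
  finally have "(\<integral>\<^sup>+x. f x \<partial>lborel) / F * ((\<integral>\<^sup>+x. g x \<partial>lborel) / G) \<le> ((\<integral>\<^sup>+x. h x \<partial>lborel) / H) ^ 2"
    by (simp add: f'_def g'_def nn_integral_divide)
  then have "H ^ 2 * ((\<integral>\<^sup>+x. f x \<partial>lborel) / F * ((\<integral>\<^sup>+x. g x \<partial>lborel) / G)) \<le> H ^ 2 * ((\<integral>\<^sup>+x. h x \<partial>lborel) / H) ^ 2"
    by (intro mult_left_mono) auto
  moreover have "H ^ 2 * ((\<integral>\<^sup>+x. f x \<partial>lborel) / F * ((\<integral>\<^sup>+x. g x \<partial>lborel) / G))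
      = (F * ((\<integral>\<^sup>+x. f x \<partial>lborel) / F)) * (G * ((\<integral>\<^sup>+x. g x \<partial>lborel) / G))"
    unfolding HH by (simp add: ac_simps)
  moreover have "F * (X / F) = X" "G * (X / G) = X" "H * (X / H) = X" for X
    using F G H by (simp_all add: ennreal_times_divide ennreal_mult_divide_eq[of _ X, unfolded mult.commute[of X]] mult.commute[of _ X] ennreal_mult_divide_eq)
  ultimately show ?thesis by (simp add: power_mult_distrib[symmetric])
qed

text \<open>The normal density is log-concave, so it satisfies the midpoint hypothesis itself;
  multiplying all three functions by it reduces the claim to Lebesgue measure.\<close>

lemma prekopa_leindler_std_normal:
  fixes f g h :: "real \<Rightarrow> ennreal"
  assumes [measurable]: "f \<in> borel_measurable borel" "g \<in> borel_measurable borel" "h \<in> borel_measurable borel"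
    and bd: "\<And>x. f x \<le> 1" "\<And>x. g x \<le> 1"
    and le: "\<And>x y. f x * g y \<le> h ((x + y) / 2) ^ 2"
  shows "(\<integral>\<^sup>+x. f x \<partial>std_normal_distribution) * (\<integral>\<^sup>+x. g x \<partial>std_normal_distribution)
    \<le> (\<integral>\<^sup>+x. h x \<partial>std_normal_distribution) ^ 2"
proof -
  let ?\<phi> = "\<lambda>x. ennreal (std_normal_density x)"
  \<comment> \<open>Bounding the density by 1 keeps the weighted functions within the bound that the
    Lebesgue version demands.\<close>
  have \<phi>1: "?\<phi> x \<le> 1" for x
  proof -
    have "1 \<le> sqrt (2 * pi)" using pi_gt3 by (intro real_le_rsqrt) simp
    then have "std_normal_density x \<le> 1"
      unfolding std_normal_density_def by (intro mult_le_one) (auto simp: field_simps)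
    then show ?thesis by (simp add: ennreal_le_1)
  qed
  have \<phi>2: "?\<phi> x * ?\<phi> y \<le> ?\<phi> ((x + y) / 2) ^ 2" for x y
  proof -
    have "exp (- x\<^sup>2 / 2) * exp (- y\<^sup>2 / 2) \<le> exp (- ((x + y) / 2)\<^sup>2 / 2) ^ 2"
      using sum_squares_bound[of x y]
      by (simp add: exp_add[symmetric] exp_double[symmetric] power2_sum power_divide field_simps)
    then have "std_normal_density x * std_normal_density y \<le> std_normal_density ((x + y) / 2) ^ 2"
      unfolding std_normal_density_def power_mult_distrib
      by (simp add: power2_eq_square divide_right_mono)
    then show ?thesis by (simp add: ennreal_mult[symmetric] ennreal_power ennreal_leI)
  qed
  have "(\<integral>\<^sup>+x. ?\<phi> x * f x \<partial>lborel) * (\<integral>\<^sup>+x. ?\<phi> x * g x \<partial>lborel) \<le> (\<integral>\<^sup>+x. ?\<phi> x * h x \<partial>lborel) ^ 2"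
  proof (rule prekopa_leindler_real)
    show "?\<phi> x * f x \<le> 1" "?\<phi> x * g x \<le> 1" for x
      using mult_mono[OF \<phi>1[of x] bd(1)[of x]] mult_mono[OF \<phi>1[of x] bd(2)[of x]] by simp_all
    show "?\<phi> x * f x * (?\<phi> y * g y) \<le> (?\<phi> ((x + y) / 2) * h ((x + y) / 2)) ^ 2" for x y
      using mult_mono[OF \<phi>2[of x y] le[of x y]] by (simp add: power_mult_distrib ac_simps)
  qed measurable
  then show ?thesis by (simp add: nn_integral_density)
qed

text \<open>Midpoints in the extensional function space are described relationally, which avoids
  arithmetic outside the index set.\<close>

lemma prekopa_leindler_PiM_std_normal:
  fixes f g h :: "('i \<Rightarrow> real) \<Rightarrow> ennreal" and I :: "'i set"
  defines "P \<equiv> Pi\<^sub>M I (\<lambda>_. std_normal_distribution)"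
  assumes "finite I"
    and "f \<in> borel_measurable P" "g \<in> borel_measurable P" "h \<in> borel_measurable P"
    and "\<And>x. f x \<le> 1" "\<And>x. g x \<le> 1"
    and "\<And>x y w. x \<in> space P \<Longrightarrow> y \<in> space P \<Longrightarrow> w \<in> space P \<Longrightarrow>
      (\<And>i. i \<in> I \<Longrightarrow> w i = (x i + y i) / 2) \<Longrightarrow> f x * g y \<le> h w ^ 2"
  shows "integral\<^sup>N P f * integral\<^sup>N P g \<le> integral\<^sup>N P h ^ 2"
  using assms(2-) unfolding P_def
proof (induction I arbitrary: f g h rule: finite_induct)
  \<comment> \<open>The product over the empty index set is a single point of mass one, and the
    claim is the hypothesis at that point.\<close>
  case empty
  then show ?case
    by (auto simp: nn_integral_empty space_PiM_empty PiM_empty nn_integral_count_space_finite)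
next
  case (insert i I)
  let ?N = std_normal_distribution
  let ?P = "Pi\<^sub>M I (\<lambda>_. ?N)"
  let ?Q = "Pi\<^sub>M (insert i I) (\<lambda>_. ?N)"
  interpret N: prob_space ?N by (rule prob_space_normal_density) simp
  interpret product_prob_space "\<lambda>_. ?N" I ..
  note [measurable] = insert.prems(1-3)
  have meas1: "(\<lambda>s. k (x(i := s))) \<in> borel_measurable borel"
    if [measurable]: "k \<in> borel_measurable ?Q" and x: "x \<in> space ?P" for k :: "('i \<Rightarrow> real) \<Rightarrow> ennreal" and x
  proof -
    have "(\<lambda>s. x(i := s)) \<in> measurable ?N ?Q"
      using x by (intro measurable_fun_upd[where J = I]) auto
    then show ?thesis using that(1) by (auto dest: measurable_comp simp: comp_def cong: measurable_cong_sets)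
  qed
  have meas2: "(\<lambda>x. \<integral>\<^sup>+s. k (x(i := s)) \<partial>?N) \<in> borel_measurable ?P"
    if [measurable]: "k \<in> borel_measurable ?Q" for k :: "('i \<Rightarrow> real) \<Rightarrow> ennreal"
    by measurable
  have fubini: "integral\<^sup>N ?Q k = (\<integral>\<^sup>+x. \<integral>\<^sup>+s. k (x(i := s)) \<partial>?N \<partial>?P)"
    if "k \<in> borel_measurable ?Q" for k
    using insert.hyps that by (intro product_nn_integral_insert)
  have sp: "x(i := s) \<in> space ?Q" if "x \<in> space ?P" for x s
    using that by (auto simp: space_PiM PiE_def extensional_def)
  show ?case
    unfolding fubini[OF insert.prems(1)] fubini[OF insert.prems(2)] fubini[OF insert.prems(3)]
  \<comment> \<open>The partial integrals over coordinate \<open>i\<close> inherit the midpoint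
    hypothesis from the one-dimensional inequality, so the induction hypothesis applies to
    them.\<close>
  proof (rule insert.IH)
    show "(\<integral>\<^sup>+s. f (x(i := s)) \<partial>?N) \<le> 1" "(\<integral>\<^sup>+s. g (x(i := s)) \<partial>?N) \<le> 1" for x
      using nn_integral_mono[of ?N "\<lambda>s. f (x(i := s))" "\<lambda>_. 1"]
        nn_integral_mono[of ?N "\<lambda>s. g (x(i := s))" "\<lambda>_. 1"] insert.prems(4,5) N.emeasure_space_1
      by auto
  next
    fix x y w assume xyw: "x \<in> space ?P" "y \<in> space ?P" "w \<in> space ?P"
      and mid: "\<And>j. j \<in> I \<Longrightarrow> w j = (x j + y j) / 2"
    show "(\<integral>\<^sup>+s. f (x(i := s)) \<partial>?N) * (\<integral>\<^sup>+s. g (y(i := s)) \<partial>?N) \<le> (\<integral>\<^sup>+s. h (w(i := s)) \<partial>?N) ^ 2"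
    proof (rule prekopa_leindler_std_normal)
      show "f (x(i := s)) * g (y(i := t)) \<le> h (w(i := (s + t) / 2)) ^ 2" for s t
      proof (rule insert.prems(6))
        show "x(i := s) \<in> space ?Q" "y(i := t) \<in> space ?Q" "w(i := (s + t) / 2) \<in> space ?Q"
          by (intro sp xyw)+
        show "(w(i := (s + t) / 2)) j = ((x(i := s)) j + (y(i := t)) j) / 2" if "j \<in> insert i I" for j
          using mid that by auto
      qed
    qed (use xyw insert.prems in \<open>auto intro!: meas1\<close>)
  qed (rule meas2, rule insert.prems)+
qed

section \<open>Joint laws of Gaussian functionals\<close>

text \<open>Under the probability measure with density \<open>v / Z\<close>, the variable
  \<open>X\<close> has the standard normal characteristic function, so Levy's theorem determines its
  law.\<close>

lemma std_normal_of_weighted_char: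
  fixes v :: "'a \<Rightarrow> real" and X :: "'a \<Rightarrow> real"
  assumes "prob_space M" and [measurable]: "X \<in> borel_measurable M" "v \<in> borel_measurable M"
    and v: "\<And>x. 0 \<le> v x" "\<And>x. v x \<le> K" and Z: "0 < integral\<^sup>L M v"
    and ch: "\<And>t. (\<integral>x. v x *\<^sub>R iexp (t * X x) \<partial>M) = integral\<^sup>L M v * exp (- (t\<^sup>2) / 2)"
    and [measurable]: "B \<in> sets borel"
  shows "(\<integral>x. v x * indicator B (X x) \<partial>M) = integral\<^sup>L M v * measure std_normal_distribution B"
proof -
  interpret prob_space M by fact
  define Z where "Z = integral\<^sup>L M v"
  have "Z > 0" using Z by (simp add: Z_def)
  have int: "integrable M v"
    by (rule integrable_const_bound[where B = K]) (use v in auto)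
  define N where "N = density M (\<lambda>x. ennreal (v x / Z))"
  have [simp]: "space N = space M" "sets N = sets M" by (auto simp: N_def)
  have "emeasure N (space N) = 1"
    using int v \<open>Z > 0\<close>
    by (simp add: N_def emeasure_density nn_integral_eq_integral Z_def[symmetric])
  then interpret N: prob_space N by (rule prob_spaceI)
  have [measurable]: "X \<in> borel_measurable N"
    by (auto simp: N_def)
  have intN: "(\<integral>x. g x \<partial>N) = (\<integral>x. v x *\<^sub>R g x \<partial>M) /\<^sub>R Z"
    if [measurable]: "g \<in> borel_measurable M" for g :: "'a \<Rightarrow> 'b::{banach, second_countable_topology}"
  proof -
    have "(\<integral>x. g x \<partial>N) = (\<integral>x. inverse Z *\<^sub>R (v x *\<^sub>R g x) \<partial>M)"
      unfolding N_def using v \<open>Z > 0\<close>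
      by (subst integral_density) (auto simp: divide_inverse mult.commute)
    then show ?thesis by (simp only: integral_scaleR_right)
  qed
  have "distr N borel X = std_normal_distribution"
  proof (rule Levy_uniqueness)
    show "real_distribution (distr N borel X)" by (rule N.real_distribution_distr) simp
    show "real_distribution std_normal_distribution" by (rule real_dist_normal_dist)
    show "char (distr N borel X) = char std_normal_distribution"
    proof
      fix t
      have "char (distr N borel X) t = (\<integral>x. iexp (t * X x) \<partial>N)"
        unfolding char_def by (subst integral_distr) auto
      also have "\<dots> = (\<integral>x. v x *\<^sub>R iexp (t * X x) \<partial>M) /\<^sub>R Z"
        by (rule intN) measurable
      also have "\<dots> = exp (- (t\<^sup>2) / 2)"
        unfolding ch Z_def[symmetric] using \<open>Z > 0\<close> by (simp add: scaleR_conv_of_real)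
      finally show "char (distr N borel X) t = char std_normal_distribution t"
        by (simp add: char_std_normal_distribution)
    qed
  qed
  then have "measure std_normal_distribution B = measure (distr N borel X) B" by simp
  also have "\<dots> = (\<integral>x. indicator B (X x) \<partial>N)"
  proof -
    have "(\<integral>x. indicator B (X x) \<partial>N) = (\<integral>x. indicator B x \<partial>distr N borel X :: real)"
      by (subst integral_distr) auto
    then show ?thesis by simp
  qed
  also have "\<dots> = (\<integral>x. v x * indicator B (X x) \<partial>M) / Z"
    by (subst intN) (auto simp: divide_inverse)
  finally show ?thesis using \<open>Z > 0\<close> by (simp add: Z_def[symmetric])
qed

text \<open>The weight \<open>2 + w\<close> is positive, so Levy's uniqueness theorem applies to the measure it
  defines; subtracting the contribution of the constant weight leaves \<open>w\<close>.\<close>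

lemma real_weight_indep_std_normal:
  fixes w :: "'a \<Rightarrow> real" and X :: "'a \<Rightarrow> real"
  assumes "prob_space M" and [measurable]: "X \<in> borel_measurable M" "w \<in> borel_measurable M"
    and w: "\<And>x. \<bar>w x\<bar> \<le> 1"
    and chX: "\<And>t. (\<integral>x. iexp (t * X x) \<partial>M) = exp (- (t\<^sup>2) / 2)"
    and ch: "\<And>t. (\<integral>x. w x *\<^sub>R iexp (t * X x) \<partial>M) = integral\<^sup>L M w * exp (- (t\<^sup>2) / 2)"
    and [measurable]: "B \<in> sets borel"
  shows "(\<integral>x. w x * indicator B (X x) \<partial>M) = integral\<^sup>L M w * measure std_normal_distribution B"
proof -
  interpret prob_space M by fact
  have b: "- 1 \<le> w x" "w x \<le> 1" for x using w[of x] by auto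
  have iw: "integrable M w"
    by (rule integrable_const_bound[where B = 1]) (use w in auto)
  have iB: "integrable M (\<lambda>x. indicator B (X x) :: real)"
    by (rule integrable_const_bound[where B = 1]) auto
  have iwB: "integrable M (\<lambda>x. w x * indicator B (X x))"
    by (rule integrable_const_bound[where B = 1]) (use w in \<open>auto simp: indicator_def\<close>)
  have ie: "integrable M (\<lambda>x. iexp (t * X x))" for t
    by (rule integrable_const_bound[where B = 1]) auto
  have iwe: "integrable M (\<lambda>x. w x *\<^sub>R iexp (t * X x))" for t
    by (rule integrable_const_bound[where B = 1]) (use w in \<open>auto\<close>)
  have pos: "0 < 2 + integral\<^sup>L M w"
    using integral_mono[of M "\<lambda>_. - 1" w] iw b(1) by (simp add: prob_space)
  have int2: "(\<integral>x. 2 + w x \<partial>M) = 2 + integral\<^sup>L M w"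
    using iw by (simp add: prob_space)
  have "(\<integral>x. (2 + w x) * indicator B (X x) \<partial>M)
      = (\<integral>x. 2 + w x \<partial>M) * measure std_normal_distribution B"
  proof (rule std_normal_of_weighted_char[where K = 3])
    show "(\<integral>x. (2 + w x) *\<^sub>R iexp (t * X x) \<partial>M) = (\<integral>x. 2 + w x \<partial>M) * exp (- (t\<^sup>2) / 2)" for t
    proof -
      have "(\<integral>x. (2 + w x) *\<^sub>R iexp (t * X x) \<partial>M) = (\<integral>x. 2 *\<^sub>R iexp (t * X x) + w x *\<^sub>R iexp (t * X x) \<partial>M)"
        by (simp add: scaleR_add_left)
      also have "\<dots> = 2 *\<^sub>R (\<integral>x. iexp (t * X x) \<partial>M) + (\<integral>x. w x *\<^sub>R iexp (t * X x) \<partial>M)"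
        using ie iwe by (subst Bochner_Integration.integral_add) auto
      finally have e: "(\<integral>x. (2 + w x) *\<^sub>R iexp (t * X x) \<partial>M)
          = 2 *\<^sub>R (\<integral>x. iexp (t * X x) \<partial>M) + (\<integral>x. w x *\<^sub>R iexp (t * X x) \<partial>M)" .
      show ?thesis unfolding e chX ch int2 by (simp add: scaleR_conv_of_real distrib_right)
    qed
    show "0 \<le> 2 + w x" "2 + w x \<le> 3" for x using b[of x] by auto
  qed (use pos int2 in \<open>auto intro: prob_space_axioms\<close>)
  moreover have "(\<integral>x. 1 * indicator B (X x) \<partial>M) = (\<integral>x. 1 \<partial>M) * measure std_normal_distribution B"
  proof (rule std_normal_of_weighted_char[where K = 1])
    show "(\<integral>x. 1 *\<^sub>R iexp (t * X x) \<partial>M) = (\<integral>x. 1 \<partial>M) * exp (- (t\<^sup>2) / 2)" for t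
      by (simp only: scaleR_one chX) (simp add: prob_space)
  qed (auto simp: prob_space intro: prob_space_axioms)
  moreover have "(\<integral>x. (2 + w x) * indicator B (X x) \<partial>M)
      = 2 * (\<integral>x. indicator B (X x) \<partial>M) + (\<integral>x. w x * indicator B (X x) \<partial>M)"
    using iB iwB by (simp add: distrib_right)
  ultimately show ?thesis unfolding int2 by (simp add: prob_space algebra_simps)
qed

text \<open>Real and imaginary parts are combinations of \<open>W\<close> and its conjugate. The
  conjugate satisfies the analogous identity, obtained by conjugating the one at \<open>- t\<close>,
  since exp(-t^2/2) is real and even in t.\<close>

lemma complex_weight_indep_std_normal:
  fixes W :: "'a \<Rightarrow> complex" and X :: "'a \<Rightarrow> real"
  assumes "prob_space M" and [measurable]: "X \<in> borel_measurable M" "W \<in> borel_measurable M"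
    and W: "\<And>x. norm (W x) \<le> 1"
    and chX: "\<And>t. (\<integral>x. iexp (t * X x) \<partial>M) = exp (- (t\<^sup>2) / 2)"
    and ch: "\<And>t. (\<integral>x. W x * iexp (t * X x) \<partial>M) = integral\<^sup>L M W * exp (- (t\<^sup>2) / 2)"
    and [measurable]: "B \<in> sets borel"
  shows "(\<integral>x. W x * indicator B (X x) \<partial>M) = integral\<^sup>L M W * measure std_normal_distribution B"
proof -
  interpret prob_space M by fact
  have [measurable]: "(\<lambda>x. cnj (W x)) \<in> borel_measurable M"
    by (rule measurable_compose[OF assms(3)])
      (intro borel_measurable_continuous_onI continuous_intros)
  have iW: "integrable M W"
    by (rule integrable_const_bound[where B = 1]) (use W in auto)
  have iWe: "integrable M (\<lambda>x. W x * iexp (t * X x))" for t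
    by (rule integrable_const_bound[where B = 1]) (use W in \<open>auto simp: norm_mult\<close>)
  have iWe': "integrable M (\<lambda>x. cnj (W x) * iexp (t * X x))" for t
    by (rule integrable_const_bound[where B = 1]) (use W in \<open>auto simp: norm_mult\<close>)
  have iWB: "integrable M (\<lambda>x. W x * indicator B (X x))"
    by (rule integrable_const_bound[where B = 1]) (use W in \<open>auto simp: norm_mult indicator_def\<close>)
  have ch': "(\<integral>x. cnj (W x) * iexp (t * X x) \<partial>M) = cnj (integral\<^sup>L M W) * exp (- (t\<^sup>2) / 2)" for t
  proof -
    have "cnj (\<integral>x. W x * iexp ((- t) * X x) \<partial>M) = (\<integral>x. cnj (W x * iexp ((- t) * X x)) \<partial>M)"
      by (rule Bochner_Integration.integral_cnj[symmetric])
    also have "\<dots> = (\<integral>x. cnj (W x) * iexp (t * X x) \<partial>M)"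
      by (intro Bochner_Integration.integral_cong) (auto simp: exp_cnj)
    finally show ?thesis by (simp only: ch) simp
  qed
  have re: "(\<integral>x. Re (W x) * indicator B (X x) \<partial>M) = (\<integral>x. Re (W x) \<partial>M) * measure std_normal_distribution B"
  proof (rule real_weight_indep_std_normal[OF assms(1,2) _ _ chX _ assms(7)])
    show "\<bar>Re (W x)\<bar> \<le> 1" for x using abs_Re_le_cmod[of "W x"] W[of x] by linarith
    fix t
    have e: "Re (W x) *\<^sub>R iexp (t * X x) = (1 / 2) * (W x * iexp (t * X x) + cnj (W x) * iexp (t * X x))" for x
      by (simp add: complex_add_cnj distrib_right[symmetric] scaleR_conv_of_real)
    have "(\<integral>x. Re (W x) *\<^sub>R iexp (t * X x) \<partial>M)
        = (1 / 2) * ((\<integral>x. W x * iexp (t * X x) \<partial>M) + (\<integral>x. cnj (W x) * iexp (t * X x) \<partial>M))"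
      unfolding e integral_mult_right_zero Bochner_Integration.integral_add[OF iWe iWe'] ..

    also have "\<dots> = (\<integral>x. Re (W x) \<partial>M) * exp (- (t\<^sup>2) / 2)"
      unfolding ch ch' distrib_right[symmetric] complex_add_cnj using iW by simp
    finally show "(\<integral>x. Re (W x) *\<^sub>R iexp (t * X x) \<partial>M) = (\<integral>x. Re (W x) \<partial>M) * exp (- (t\<^sup>2) / 2)" .
  qed measurable
  have im: "(\<integral>x. Im (W x) * indicator B (X x) \<partial>M) = (\<integral>x. Im (W x) \<partial>M) * measure std_normal_distribution B"
  proof (rule real_weight_indep_std_normal[OF assms(1,2) _ _ chX _ assms(7)])
    show "\<bar>Im (W x)\<bar> \<le> 1" for x using abs_Im_le_cmod[of "W x"] W[of x] by linarith
    fix t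
    have e: "Im (W x) *\<^sub>R iexp (t * X x) = (- \<i> / 2) * (W x * iexp (t * X x) - cnj (W x) * iexp (t * X x))" for x
      unfolding left_diff_distrib[symmetric] complex_diff_cnj scaleR_conv_of_real mult.assoc[symmetric]
      by (rule arg_cong[where f = "\<lambda>c. c * _"]) (simp add: complex_eq_iff)
    have "(\<integral>x. Im (W x) *\<^sub>R iexp (t * X x) \<partial>M)
        = (- \<i> / 2) * ((\<integral>x. W x * iexp (t * X x) \<partial>M) - (\<integral>x. cnj (W x) * iexp (t * X x) \<partial>M))"
      unfolding e integral_mult_right_zero Bochner_Integration.integral_diff[OF iWe iWe'] ..

    also have "\<dots> = (\<integral>x. Im (W x) \<partial>M) * exp (- (t\<^sup>2) / 2)"
      unfolding ch ch' left_diff_distrib[symmetric] complex_diff_cnj using iW by (simp add: complex_eq_iff)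
    finally show "(\<integral>x. Im (W x) *\<^sub>R iexp (t * X x) \<partial>M) = (\<integral>x. Im (W x) \<partial>M) * exp (- (t\<^sup>2) / 2)" .
  qed measurable
  have c: "Re (indicator B x) = indicator B x" "Im (indicator B x) = 0" for x :: real
    by (auto simp: indicator_def)
  have "Re (\<integral>x. W x * indicator B (X x) \<partial>M) = (\<integral>x. Re (W x) * indicator B (X x) \<partial>M)"
    using iWB by (subst integral_Re[symmetric]) (auto simp: c)
  moreover have "Im (\<integral>x. W x * indicator B (X x) \<partial>M) = (\<integral>x. Im (W x) * indicator B (X x) \<partial>M)"
    using iWB by (subst integral_Im[symmetric]) (auto simp: c)
  ultimately show ?thesis using re im iW by (simp add: complex_eq_iff)
qed

section \<open>Joint laws from joint characteristic functions\<close>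

lemma prod_indicator_eq:
  "finite I \<Longrightarrow> (\<Prod>j\<in>I. indicator (B j) (f j)) = (if \<forall>j\<in>I. f j \<in> B j then 1 else 0 :: 'a::semidom)"
  by (induction I rule: finite_induct) auto

text \<open>Exponentials are exchanged for indicators one coordinate at a time, each exchange
  resting on one-dimensional uniqueness with a complex weight. The outcome is the mass of every box,
  which determines the product measure.\<close>

lemma distr_eq_PiM_std_normal:
  fixes \<psi> :: "nat \<Rightarrow> 'a \<Rightarrow> real"
  assumes "prob_space M" and [measurable]: "\<And>j. \<psi> j \<in> borel_measurable M"
    and ch: "\<And>s. (\<integral>x. iexp (\<Sum>j<m. s j * \<psi> j x) \<partial>M) = exp (- (\<Sum>j<m. (s j)\<^sup>2) / 2)"
  shows "distr M (Pi\<^sub>M {..<m} (\<lambda>_. borel)) (\<lambda>x. \<lambda>j\<in>{..<m}. \<psi> j x)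
    = Pi\<^sub>M {..<m} (\<lambda>_. std_normal_distribution)"
proof -
  interpret M: prob_space M by fact
  let ?N = std_normal_distribution
  interpret N: prob_space ?N by (rule prob_space_normal_density) simp
  interpret product_prob_space "\<lambda>_. ?N" "{..<m}" ..
  \<comment> \<open>A hybrid expression: the first \<open>k\<close> coordinates carry indicators,
    the others exponentials. For \<open>k = 0\<close> it is the hypothesis, for \<open>k = m\<close>
    the mass of a box.\<close>
  have claim: "(\<integral>x. (\<Prod>j<k. indicator (B j) (\<psi> j x)) * iexp (\<Sum>j\<in>{k..<m}. s j * \<psi> j x) \<partial>M)
      = (\<Prod>j<k. measure ?N (B j)) * exp (- (\<Sum>j\<in>{k..<m}. (s j)\<^sup>2) / 2)"
    if "k \<le> m" and B: "\<And>j. B j \<in> sets borel" for k s and B :: "nat \<Rightarrow> real set"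
    using that(1)
  proof (induction k arbitrary: s)
    case 0
    then show ?case using ch[of s] by (simp add: atLeast0LessThan)
  next
    case (Suc k)
    note [measurable] = B
    \<comment> \<open>\<open>W\<close> collects the factors of all coordinates except
      \<open>k\<close>, so the step from \<open>k\<close> to \<open>Suc k\<close> exchanges only the
      factor of \<open>\<psi> k\<close>.\<close>
    define W where "W x = (\<Prod>j<k. indicator (B j) (\<psi> j x)) * iexp (\<Sum>j\<in>{Suc k..<m}. s j * \<psi> j x)" for x
    have split: "{k..<m} = insert k {Suc k..<m}" using Suc.prems by auto
    have ind1: "norm (\<Prod>j<k. indicator (B j) (\<psi> j x) :: complex) \<le> 1" for x
      by (subst prod_norm[symmetric], rule prod_le_1) (auto simp: indicator_def)
    \<comment> \<open>Varying the coefficient of coordinate \<open>k\<close> in the induction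
      hypothesis shows that the weighted characteristic function of \<open>\<psi> k\<close> is a
      constant times exp(-t^2/2); \<open>t = 0\<close> identifies the constant.\<close>
    have IH: "(\<integral>x. W x * iexp (t * \<psi> k x) \<partial>M)
        = (\<Prod>j<k. measure ?N (B j)) * exp (- (\<Sum>j\<in>{Suc k..<m}. (s j)\<^sup>2) / 2) * exp (- (t\<^sup>2) / 2)" for t
    proof -
      have "W x * iexp (t * \<psi> k x) = (\<Prod>j<k. indicator (B j) (\<psi> j x))
          * iexp (\<Sum>j\<in>{k..<m}. (s(k := t)) j * \<psi> j x)" for x
      proof -
        have "(\<Sum>j\<in>{k..<m}. (s(k := t)) j * \<psi> j x) = t * \<psi> k x + (\<Sum>j\<in>{Suc k..<m}. s j * \<psi> j x)"
          unfolding split by (subst sum.insert) (auto intro!: sum.cong)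
        then show ?thesis by (simp add: W_def exp_add distrib_left mult.assoc mult.commute)
      qed
      moreover have "(\<Sum>j\<in>{k..<m}. ((s(k := t)) j)\<^sup>2) = t\<^sup>2 + (\<Sum>j\<in>{Suc k..<m}. (s j)\<^sup>2)"
        unfolding split by (subst sum.insert) (auto intro!: sum.cong)
      moreover have "exp (- (t\<^sup>2 + (\<Sum>j\<in>{Suc k..<m}. (s j)\<^sup>2)) / 2)
          = exp (- (\<Sum>j\<in>{Suc k..<m}. (s j)\<^sup>2) / 2) * exp (- (t\<^sup>2) / 2)"
        by (simp add: exp_add[symmetric] field_simps)
      ultimately show ?thesis
        using Suc.IH[of "s(k := t)"] Suc.prems by (simp only: of_real_mult mult.assoc)
    qed
    have W0: "integral\<^sup>L M W = (\<Prod>j<k. measure ?N (B j)) * exp (- (\<Sum>j\<in>{Suc k..<m}. (s j)\<^sup>2) / 2)"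
      using IH[of 0] by simp
    have "(\<integral>x. W x * indicator (B k) (\<psi> k x) \<partial>M) = integral\<^sup>L M W * measure ?N (B k)"
    proof (rule complex_weight_indep_std_normal)
      show "norm (W x) \<le> 1" for x using ind1[of x] by (simp add: W_def norm_mult)
      show "(\<integral>x. iexp (t * \<psi> k x) \<partial>M) = exp (- (t\<^sup>2) / 2)" for t
      proof -
        have "(\<Sum>j<m. (if j = k then t else 0) * \<psi> j x) = t * \<psi> k x" for x
          using Suc.prems by (subst sum.remove[of _ k]) auto
        moreover have "(\<Sum>j<m. (if j = k then t else 0)\<^sup>2) = t\<^sup>2"
          using Suc.prems by (subst sum.remove[of _ k]) auto
        ultimately show ?thesis using ch[of "\<lambda>j. if j = k then t else 0"] by simp
      qed
      show "(\<integral>x. W x * iexp (t * \<psi> k x) \<partial>M) = integral\<^sup>L M W * exp (- (t\<^sup>2) / 2)" for t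
        unfolding IH W0 by simp
      show "W \<in> borel_measurable M" unfolding W_def by measurable
    qed (auto intro: assms(1) B)
    moreover have "(\<Prod>j<Suc k. indicator (B j) (\<psi> j x)) * iexp (\<Sum>j\<in>{Suc k..<m}. s j * \<psi> j x)
        = W x * indicator (B k) (\<psi> k x)" for x
      unfolding W_def lessThan_Suc by (subst prod.insert) (simp_all only: finite_lessThan lessThan_iff less_irrefl not_False_eq_True mult.assoc mult.commute mult.left_commute)
    moreover have "(\<Prod>j<Suc k. measure ?N (B j)) = (\<Prod>j<k. measure ?N (B j)) * measure ?N (B k)"
      by simp
    ultimately show ?case unfolding W0 by (simp only: of_real_mult mult.assoc mult.commute mult.left_commute)
  qed
  show ?thesis
  proof (rule PiM_eqI)
    fix A :: "nat \<Rightarrow> real set" assume A: "\<And>i. i \<in> {..<m} \<Longrightarrow> A i \<in> sets ?N"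
    define B where "B j = (if j < m then A j else {})" for j
    have B[measurable]: "B j \<in> sets borel" for j using A by (auto simp: B_def)
    have "emeasure (distr M (Pi\<^sub>M {..<m} (\<lambda>_. borel)) (\<lambda>x. \<lambda>j\<in>{..<m}. \<psi> j x)) (Pi\<^sub>E {..<m} A)
        = emeasure M {x\<in>space M. \<forall>j<m. \<psi> j x \<in> B j}"
      using A by (subst emeasure_distr)
        (auto simp: B_def vimage_def intro!: sets_PiM_I_finite arg_cong[where f = "emeasure M"])
    also have "\<dots> = ennreal (measure M {x\<in>space M. \<forall>j<m. \<psi> j x \<in> B j})"
      by (simp add: M.emeasure_eq_measure)
    also have "measure M {x\<in>space M. \<forall>j<m. \<psi> j x \<in> B j} = (\<Prod>j<m. measure ?N (B j))"
    proof -
      have "of_real (measure M {x\<in>space M. \<forall>j<m. \<psi> j x \<in> B j})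
          = (\<integral>x. of_real (indicator {x\<in>space M. \<forall>j<m. \<psi> j x \<in> B j} x) \<partial>M :: complex)"
        by (subst integral_of_real) (simp_all add: M.emeasure_finite less_top[symmetric])
      also have "\<dots> = (\<integral>x. (\<Prod>j<m. indicator (B j) (\<psi> j x)) * iexp (\<Sum>j\<in>{m..<m}. 0 * \<psi> j x) \<partial>M)"
        by (intro Bochner_Integration.integral_cong refl)
          (auto simp: prod_indicator_eq indicator_def)
      also have "\<dots> = of_real (\<Prod>j<m. measure ?N (B j))"
        using claim[of m B "\<lambda>_. 0"] B by simp
      finally show ?thesis by (simp only: of_real_eq_iff)
    qed
    also have "ennreal (\<Prod>j<m. measure ?N (B j)) = (\<Prod>j<m. emeasure ?N (B j))"
      by (simp add: N.emeasure_eq_measure prod_ennreal)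
    also have "\<dots> = (\<Prod>j<m. emeasure ?N (A j))" by (simp add: B_def)
    finally show "emeasure (distr M (Pi\<^sub>M {..<m} (\<lambda>_. borel)) (\<lambda>x. \<lambda>j\<in>{..<m}. \<psi> j x)) (Pi\<^sub>E {..<m} A)
        = (\<Prod>j<m. emeasure ?N (A j))" .
  qed (auto intro!: sets_PiM_cong)
qed

section \<open>Linear functionals under a centered Gaussian measure\<close>

lemma centered_gaussian_measurable:
  assumes "centered_gaussian M" "bounded_linear (\<phi> :: 'a::real_normed_vector \<Rightarrow> real)"
  shows "\<phi> \<in> borel_measurable M"
proof -
  have "\<phi> \<in> borel_measurable borel"
    using assms(2) by (intro borel_measurable_continuous_onI linear_continuous_on)
  moreover have "sets M = sets borel" using assms(1) by (simp add: centered_gaussian_def)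
  ultimately show ?thesis by (simp cong: measurable_cong_sets)
qed

lemma normal_distr_std_normal:
  assumes "\<sigma> > 0"
  shows "density lborel (\<lambda>x. ennreal (normal_density 0 \<sigma> x)) = distr std_normal_distribution borel (\<lambda>x. \<sigma> * x)"
proof -
  interpret prob_space std_normal_distribution by (rule prob_space_normal_density) simp
  have "distributed std_normal_distribution lborel (\<lambda>x. x) std_normal_density"
    by (auto simp: distributed_def distr_id2)
  from normal_density_affine[OF this, of \<sigma> 0] assms
  have "distributed std_normal_distribution lborel (\<lambda>x. \<sigma> * x) (normal_density 0 \<sigma>)" by simp
  then have "distr std_normal_distribution lborel (\<lambda>x. \<sigma> * x) = density lborel (normal_density 0 \<sigma>)"
    by (simp add: distributed_def)
  then show ?thesis by (simp cong: distr_cong)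
qed

text \<open>Expressing the exponent by the second moment lets one formula cover both the point mass
  at 0 and the law of \<sigma> times a standard normal variable.\<close>

lemma centered_gaussian_real_moments:
  assumes "centered_gaussian_real N"
  shows "integrable N (\<lambda>x. x\<^sup>2)" "(\<integral>x. iexp x \<partial>N) = exp (- (\<integral>x. x\<^sup>2 \<partial>N) / 2)"
proof -
  have "integrable N (\<lambda>x. x\<^sup>2) \<and> (\<integral>x. iexp x \<partial>N) = exp (- (\<integral>x. x\<^sup>2 \<partial>N) / 2)"
  proof (cases "N = return borel 0")
    case True
    have "integrable (return borel (0::real)) (\<lambda>x. x\<^sup>2)"
    proof (rule finite_measure.integrable_const_bound[where B = 0])
      show "finite_measure (return borel (0::real))"
        by (intro prob_space.finite_measure prob_space_return) simp
    qed (auto simp: AE_return)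
    then show ?thesis by (simp add: True integral_return)
  next
    case False
    then obtain \<sigma> where \<sigma>: "\<sigma> > 0" and N: "N = distr std_normal_distribution borel (\<lambda>x. \<sigma> * x)"
      using assms normal_distr_std_normal unfolding centered_gaussian_real_def by metis
    have "integrable N (\<lambda>x. x\<^sup>2)"
      using integrable_std_normal_distribution_moment[of 2]
      by (simp add: N integrable_distr_eq power_mult_distrib)
    moreover have "(\<integral>x. x\<^sup>2 \<partial>N) = \<sigma>\<^sup>2"
      using std_normal_distribution_even_moments(1)[of 1]
      by (simp add: N integral_distr power_mult_distrib fact_numeral)
    moreover have "(\<integral>x. iexp x \<partial>N) = exp (- (\<sigma>\<^sup>2) / 2)"
    proof -
      have "(\<integral>x. iexp x \<partial>N) = char std_normal_distribution \<sigma>"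
        by (simp add: N integral_distr char_def)
      then show ?thesis by (simp add: char_std_normal_distribution)
    qed
    ultimately show ?thesis by simp
  qed
  then show "integrable N (\<lambda>x. x\<^sup>2)" "(\<integral>x. iexp x \<partial>N) = exp (- (\<integral>x. x\<^sup>2 \<partial>N) / 2)" by auto
qed

lemma
  assumes M: "centered_gaussian M" and \<phi>: "bounded_linear (\<phi> :: 'a::real_normed_vector \<Rightarrow> real)"
  shows centered_gaussian_square_integrable: "integrable M (\<lambda>x. (\<phi> x)\<^sup>2)"
    and centered_gaussian_char: "(\<integral>x. iexp (\<phi> x) \<partial>M) = exp (- (\<integral>x. (\<phi> x)\<^sup>2 \<partial>M) / 2)"
proof -
  have [measurable]: "\<phi> \<in> borel_measurable M" by (rule centered_gaussian_measurable[OF M \<phi>])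
  have "centered_gaussian_real (distr M borel \<phi>)"
    using M \<phi> by (simp add: centered_gaussian_def)
  note m = centered_gaussian_real_moments[OF this]
  show "integrable M (\<lambda>x. (\<phi> x)\<^sup>2)" using m(1) by (simp add: integrable_distr_eq)
  show "(\<integral>x. iexp (\<phi> x) \<partial>M) = exp (- (\<integral>x. (\<phi> x)\<^sup>2 \<partial>M) / 2)"
    using m(2) by (simp add: integral_distr)
qed

lemma centered_gaussian_product_integrable:
  assumes M: "centered_gaussian M"
    and "bounded_linear (\<phi> :: 'a::real_normed_vector \<Rightarrow> real)" "bounded_linear (\<psi> :: 'a \<Rightarrow> real)"
  shows "integrable M (\<lambda>x. \<phi> x * \<psi> x)"
proof (rule Bochner_Integration.integrable_bound)
  note [measurable] = centered_gaussian_measurable[OF M]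
  show "integrable M (\<lambda>x. (\<phi> x)\<^sup>2 + (\<psi> x)\<^sup>2)"
    using assms by (intro Bochner_Integration.integrable_add centered_gaussian_square_integrable)
  show "(\<lambda>x. \<phi> x * \<psi> x) \<in> borel_measurable M" using assms by measurable
  have "\<bar>a * b\<bar> \<le> a\<^sup>2 + b\<^sup>2" for a b :: real
    using sum_squares_bound[of a b] sum_squares_bound[of a "- b"] by (auto simp: abs_if)
  then show "AE x in M. norm (\<phi> x * \<psi> x) \<le> norm ((\<phi> x)\<^sup>2 + (\<psi> x)\<^sup>2)" by simp
qed

text \<open>Gram-Schmidt in L^2 of \<open>M\<close>. A residual of variance zero adds no new
  functional, because it vanishes almost everywhere; hence the expansion is an identity almost
  everywhere.\<close>

lemma centered_gaussian_gram_schmidt: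
  fixes \<phi> :: "nat \<Rightarrow> 'a::real_normed_vector \<Rightarrow> real"
  assumes M: "centered_gaussian M" and \<phi>: "\<And>i. bounded_linear (\<phi> i)"
  shows "\<exists>m \<psi> T. (\<forall>j. bounded_linear (\<psi> j))
    \<and> (\<forall>i<m. \<forall>j<m. (\<integral>x. \<psi> i x * \<psi> j x \<partial>M) = (if i = j then 1 else 0))
    \<and> (\<forall>i<n. AE x in M. \<phi> i x = (\<Sum>j<(m::nat). T i j * \<psi> j x))"
proof (induction n)
  case 0
  show ?case by (rule exI[of _ 0]) (use \<phi> in auto)
next
  case (Suc n)
  then obtain m \<psi> T where \<psi>: "\<And>j. bounded_linear (\<psi> j)"
    and orth: "\<And>i j. i < m \<Longrightarrow> j < m \<Longrightarrow> (\<integral>x. \<psi> i x * \<psi> j x \<partial>M) = (if i = j then 1 else 0)"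
    and T: "\<And>i. i < n \<Longrightarrow> AE x in M. \<phi> i x = (\<Sum>j<(m::nat). T i j * \<psi> j x)"
    by blast
  define c where "c j = (\<integral>x. \<phi> n x * \<psi> j x \<partial>M)" for j
  define \<eta> where "\<eta> x = \<phi> n x - (\<Sum>j<m. c j * \<psi> j x)" for x
  define V where "V = (\<integral>x. (\<eta> x)\<^sup>2 \<partial>M)"
  have \<eta>: "bounded_linear \<eta>"
    unfolding \<eta>_def using \<phi> \<psi>
    by (intro bounded_linear_sub bounded_linear_sum bounded_linear_const_mult)
  have [measurable]: "\<eta> \<in> borel_measurable M" by (rule centered_gaussian_measurable[OF M \<eta>])
  note int = centered_gaussian_product_integrable[OF M]
  have orth\<eta>: "(\<integral>x. \<eta> x * \<psi> j x \<partial>M) = 0" if "j < m" for j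
  proof -
    have "(\<integral>x. \<eta> x * \<psi> j x \<partial>M) = (\<integral>x. \<phi> n x * \<psi> j x - (\<Sum>k<m. c k * (\<psi> k x * \<psi> j x)) \<partial>M)"
      by (simp add: \<eta>_def left_diff_distrib sum_distrib_right mult.assoc)
    also have "\<dots> = c j - (\<Sum>k<m. c k * (\<integral>x. \<psi> k x * \<psi> j x \<partial>M))"
      unfolding c_def using int[OF \<phi> \<psi>] int[OF \<psi> \<psi>] by simp
    also have "(\<Sum>k<m. c k * (\<integral>x. \<psi> k x * \<psi> j x \<partial>M)) = c j"
      using that orth by (subst sum.remove[of _ j]) auto
    finally show ?thesis by simp
  qed
  show ?case
  proof (cases "V = 0")
    case True
    then have "AE x in M. (\<eta> x)\<^sup>2 = 0"
      unfolding V_def using centered_gaussian_square_integrable[OF M \<eta>]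
      by (subst (asm) integral_nonneg_eq_0_iff_AE) auto
    then have "AE x in M. \<phi> n x = (\<Sum>j<m. c j * \<psi> j x)" by eventually_elim (simp add: \<eta>_def)
    then have "\<forall>i<Suc n. AE x in M. \<phi> i x = (\<Sum>j<m. (T(n := c)) i j * \<psi> j x)"
      using T by (auto simp: less_Suc_eq)
    then show ?thesis using \<psi> orth by blast
  next
    case False
    moreover have "0 \<le> V" by (simp add: V_def)
    ultimately have V: "V > 0" by simp
    define \<psi>' where "\<psi>' = \<psi>(m := \<lambda>x. \<eta> x / sqrt V)"
    \<comment> \<open>Column \<open>m\<close> belongs to the new functional: it is zero in the old
      rows, and in row \<open>n\<close> the entry \<open>sqrt V\<close> undoes the
      normalisation.\<close>
    define T' where "T' i j = (if i = n then (if j = m then sqrt V else c j) else if j = m then 0 else T i j)" for i j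
    have "bounded_linear (\<psi>' j)" for j
      unfolding \<psi>'_def using \<psi> \<eta> by (auto intro: bounded_linear_divide[THEN bounded_linear_compose])
    moreover have "(\<integral>x. \<psi>' i x * \<psi>' j x \<partial>M) = (if i = j then 1 else 0)" if "i < Suc m" "j < Suc m" for i j
    proof -
      consider "i = m" "j = m" | "i = m" "j < m" | "i < m" "j = m" | "i < m" "j < m"
        using \<open>i < Suc m\<close> \<open>j < Suc m\<close> by linarith
      then show ?thesis
      proof cases
        case 1
        then have "(\<integral>x. \<psi>' i x * \<psi>' j x \<partial>M) = (\<integral>x. (\<eta> x)\<^sup>2 / V \<partial>M)"
          using V by (simp add: \<psi>'_def power2_eq_square)
        then show ?thesis using 1 V by (simp add: V_def[symmetric])
      next
        case 2
        then show ?thesis using orth\<eta>[of j] by (simp add: \<psi>'_def)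
      next
        case 3
        then show ?thesis using orth\<eta>[of i] by (simp add: \<psi>'_def mult.commute)
      next
        case 4
        then show ?thesis using orth by (simp add: \<psi>'_def)
      qed
    qed
    moreover have "AE x in M. \<phi> i x = (\<Sum>j<Suc m. T' i j * \<psi>' j x)" if "i < Suc n" for i
    proof (cases "i = n")
      case True
      then show ?thesis using V by (simp add: T'_def \<psi>'_def \<eta>_def)
    next
      case False
      then have "AE x in M. \<phi> i x = (\<Sum>j<m. T i j * \<psi> j x)" using that T by simp
      then show ?thesis using False by (simp add: T'_def \<psi>'_def)
    qed
    ultimately show ?thesis by (intro exI[of _ "Suc m"] exI[of _ \<psi>'] exI[of _ T']) auto
  qed
qed

text \<open>By orthonormality the variance of a linear combination is the sum of its squared
  coefficients, so the joint characteristic function is that of independent standard normal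
  variables.\<close>

lemma centered_gaussian_orthonormal_distr:
  fixes \<psi> :: "nat \<Rightarrow> 'a::real_normed_vector \<Rightarrow> real"
  assumes M: "centered_gaussian M" and \<psi>: "\<And>j. bounded_linear (\<psi> j)"
    and orth: "\<And>i j. i < m \<Longrightarrow> j < m \<Longrightarrow> (\<integral>x. \<psi> i x * \<psi> j x \<partial>M) = (if i = j then 1 else 0)"
  shows "distr M (Pi\<^sub>M {..<m} (\<lambda>_. borel)) (\<lambda>x. \<lambda>j\<in>{..<m}. \<psi> j x)
    = Pi\<^sub>M {..<m} (\<lambda>_. std_normal_distribution)"
proof (rule distr_eq_PiM_std_normal)
  show "prob_space M" using M by (simp add: centered_gaussian_def)
  show "\<psi> j \<in> borel_measurable M" for j by (rule centered_gaussian_measurable[OF M \<psi>])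
  fix s
  have "bounded_linear (\<lambda>x. \<Sum>j<m. s j * \<psi> j x)"
    using \<psi> by (intro bounded_linear_sum bounded_linear_const_mult)
  from centered_gaussian_char[OF M this]
  have "(\<integral>x. iexp (\<Sum>j<m. s j * \<psi> j x) \<partial>M) = exp (- (\<integral>x. (\<Sum>j<m. s j * \<psi> j x)\<^sup>2 \<partial>M) / 2)" .
  also have "(\<integral>x. (\<Sum>j<m. s j * \<psi> j x)\<^sup>2 \<partial>M) = (\<integral>x. (\<Sum>i<m. \<Sum>j<m. s i * s j * (\<psi> i x * \<psi> j x)) \<partial>M)"
    by (simp add: power2_eq_square sum_product ac_simps)
  also have "\<dots> = (\<Sum>i<m. \<Sum>j<m. s i * s j * (\<integral>x. \<psi> i x * \<psi> j x \<partial>M))"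
    using centered_gaussian_product_integrable[OF M \<psi> \<psi>] by simp
  also have "\<dots> = (\<Sum>i<m. \<Sum>j<m. if i = j then (s i)\<^sup>2 else 0)"
    by (intro sum.cong refl) (auto simp: orth power2_eq_square)
  also have "\<dots> = (\<Sum>j<m. (s j)\<^sup>2)" by (simp add: sum.delta)
  finally show "(\<integral>x. iexp (\<Sum>j<m. s j * \<psi> j x) \<partial>M) = exp (- (\<Sum>j<m. (s j)\<^sup>2) / 2)" .
qed

section \<open>Anderson's inequality for balls\<close>

text \<open>In orthonormal coordinates the shifted cylinder becomes \<open>A c\<close>, up to a null
  set. Midpoints between \<open>A c\<close> and its reflection \<open>A (\<lambda>i. - c i)\<close>
  lie in the centred set, so Prekopa-Leindler for indicators bounds the product of their equal
  masses by the squared mass of the centred set.\<close>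

lemma anderson_cylinder:
  fixes \<phi> :: "nat \<Rightarrow> 'a::real_normed_vector \<Rightarrow> real"
  assumes M: "centered_gaussian M" and \<phi>: "\<And>i. bounded_linear (\<phi> i)"
  shows "measure M {x\<in>space M. \<forall>i<n. \<bar>\<phi> i x - c i\<bar> \<le> t} \<le> measure M {x\<in>space M. \<forall>i<n. \<bar>\<phi> i x\<bar> \<le> t}"
proof -
  obtain m \<psi> T where \<psi>: "\<And>j. bounded_linear (\<psi> j)"
    and orth: "\<And>i j. i < m \<Longrightarrow> j < m \<Longrightarrow> (\<integral>x. \<psi> i x * \<psi> j x \<partial>M) = (if i = j then 1 else 0)"
    and T: "\<And>i. i < n \<Longrightarrow> AE x in M. \<phi> i x = (\<Sum>j<(m::nat). T i j * \<psi> j x)"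
    using centered_gaussian_gram_schmidt[where \<phi> = \<phi> and n = n, OF M \<phi>] by blast
  let ?B = "Pi\<^sub>M {..<m} (\<lambda>_. borel :: real measure)"
  define P where "P = Pi\<^sub>M {..<m} (\<lambda>_. std_normal_distribution)"
  interpret N: prob_space std_normal_distribution by (rule prob_space_normal_density) simp
  interpret P: prob_space P unfolding P_def by (rule prob_space_PiM) (rule N.prob_space_axioms)
  interpret M: prob_space M using M by (simp add: centered_gaussian_def)
  have [measurable]: "\<phi> i \<in> borel_measurable M" "\<psi> i \<in> borel_measurable M" for i
    by (intro centered_gaussian_measurable[OF M] \<phi> \<psi>)+
  have [measurable_cong, simp]: "sets P = sets ?B" unfolding P_def by (intro sets_PiM_cong) auto
  have [simp]: "space P = space ?B" by (rule sets_eq_imp_space_eq) simp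
  define A where "A d = {\<xi>\<in>space ?B. \<forall>i<n. \<bar>(\<Sum>j<m. T i j * \<xi> j) - d i\<bar> \<le> t}" for d :: "nat \<Rightarrow> real"
  have [measurable]: "A d \<in> sets ?B" for d unfolding A_def by measurable
  have pos: "measure P (A d) = measure M {x\<in>space M. \<forall>i<n. \<bar>(\<Sum>j<m. T i j * \<psi> j x) - d i\<bar> \<le> t}" for d
  proof -
    have "P = distr M ?B (\<lambda>x. \<lambda>j\<in>{..<m}. \<psi> j x)"
      unfolding P_def by (rule centered_gaussian_orthonormal_distr[OF M \<psi> orth, symmetric])
    then have "measure P (A d) = measure M ((\<lambda>x. \<lambda>j\<in>{..<m}. \<psi> j x) -` A d \<inter> space M)"
      by (simp add: measure_distr)
    also have "(\<lambda>x. \<lambda>j\<in>{..<m}. \<psi> j x) -` A d \<inter> space M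
        = {x\<in>space M. \<forall>i<n. \<bar>(\<Sum>j<m. T i j * \<psi> j x) - d i\<bar> \<le> t}"
      by (auto simp: A_def space_PiM)
    finally show ?thesis .
  qed
  \<comment> \<open>The negated functionals are orthonormal as well and have the same joint law,
    which yields the reflection symmetry of \<open>P\<close>.\<close>
  have neg: "measure P (A d) = measure M {x\<in>space M. \<forall>i<n. \<bar>(\<Sum>j<m. T i j * \<psi> j x) + d i\<bar> \<le> t}" for d
  proof -
    have "P = distr M ?B (\<lambda>x. \<lambda>j\<in>{..<m}. - \<psi> j x)"
      unfolding P_def
      by (rule centered_gaussian_orthonormal_distr[OF M, symmetric])
        (use \<psi> orth in \<open>auto intro: bounded_linear_minus\<close>)
    then have "measure P (A d) = measure M ((\<lambda>x. \<lambda>j\<in>{..<m}. - \<psi> j x) -` A d \<inter> space M)"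
      by (simp add: measure_distr)
    also have "(\<lambda>x. \<lambda>j\<in>{..<m}. - \<psi> j x) -` A d \<inter> space M
        = {x\<in>space M. \<forall>i<n. \<bar>- (\<Sum>j<m. T i j * \<psi> j x) - d i\<bar> \<le> t}"
      by (auto simp: A_def space_PiM sum_negf)
    also have "\<dots> = {x\<in>space M. \<forall>i<n. \<bar>(\<Sum>j<m. T i j * \<psi> j x) + d i\<bar> \<le> t}"
    proof -
      have "\<bar>- u - v\<bar> = \<bar>u + v\<bar>" for u v :: real by linarith
      then show ?thesis by simp
    qed
    finally show ?thesis .
  qed
  have sym: "measure P (A (\<lambda>i. - c i)) = measure P (A c)"
    using pos[of "\<lambda>i. - c i"] neg[of c] by simp
  have "integral\<^sup>N P (indicator (A c)) * integral\<^sup>N P (indicator (A (\<lambda>i. - c i)))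
      \<le> integral\<^sup>N P (indicator (A (\<lambda>_. 0))) ^ 2"
    unfolding P_def
  proof (rule prekopa_leindler_PiM_std_normal, unfold P_def[symmetric])
    fix x y w assume sp: "x \<in> space P" "y \<in> space P" "w \<in> space P"
      and mid: "\<And>i. i \<in> {..<m} \<Longrightarrow> w i = (x i + y i) / 2"
    have "w \<in> A (\<lambda>_. 0)" if "x \<in> A c" "y \<in> A (\<lambda>i. - c i)"
    proof -
      have "\<bar>(\<Sum>j<m. T i j * w j)\<bar> \<le> t" if "i < n" for i
      proof -
        have "(\<Sum>j<m. T i j * w j) = ((\<Sum>j<m. T i j * x j) + (\<Sum>j<m. T i j * y j)) / 2"
          unfolding sum.distrib[symmetric] sum_divide_distrib
          by (intro sum.cong refl) (simp add: mid distrib_left)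
        moreover have "\<bar>(\<Sum>j<m. T i j * x j) - c i\<bar> \<le> t" "\<bar>(\<Sum>j<m. T i j * y j) + c i\<bar> \<le> t"
          using \<open>x \<in> A c\<close> \<open>y \<in> A (\<lambda>i. - c i)\<close> \<open>i < n\<close> by (auto simp: A_def)
        ultimately show ?thesis by (simp add: abs_le_iff)
      qed
      then show ?thesis using sp by (auto simp: A_def)
    qed
    then show "indicator (A c) x * indicator (A (\<lambda>i. - c i)) y \<le> (indicator (A (\<lambda>_. 0)) w ^ 2 :: ennreal)"
      by (auto simp: indicator_def)
  qed (auto simp: indicator_def)
  then have "ennreal (measure P (A c) * measure P (A c)) \<le> ennreal ((measure P (A (\<lambda>_. 0)))\<^sup>2)"
    by (simp add: P.emeasure_eq_measure sym ennreal_mult ennreal_power)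
  then have "(measure P (A c))\<^sup>2 \<le> (measure P (A (\<lambda>_. 0)))\<^sup>2"
    by (simp add: power2_eq_square)
  then have le: "measure P (A c) \<le> measure P (A (\<lambda>_. 0))"
    by (rule power2_le_imp_le) simp
  have AE: "AE x in M. \<forall>i<n. \<phi> i x = (\<Sum>j<m. T i j * \<psi> j x)"
    using T by (simp add: AE_all_countable)
  have "measure M {x\<in>space M. \<forall>i<n. \<bar>\<phi> i x - d i\<bar> \<le> t} = measure P (A d)" for d
    unfolding pos by (rule M.finite_measure_eq_AE) (use AE in eventually_elim, auto)
  from this[of c] this[of "\<lambda>_. 0"] le show ?thesis by simp
qed

text \<open>A norming sequence exhibits each ball as a decreasing intersection of cylinders, and
  continuity from above carries the cylinder inequality over.\<close>

theorem anderson_cball: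
  fixes z :: "'a::{real_normed_vector, second_countable_topology}"
  assumes M: "centered_gaussian M"
  shows "measure M (cball z t) \<le> measure M (cball 0 t)"
proof -
  obtain \<phi> :: "nat \<Rightarrow> 'a \<Rightarrow> real" where \<phi>: "\<And>n. bounded_linear (\<phi> n)"
    and norm: "\<And>x t. norm x \<le> t \<longleftrightarrow> (\<forall>n. \<bar>\<phi> n x\<bar> \<le> t)"
    using exists_norming_sequence by metis
  interpret M: prob_space M using M by (simp add: centered_gaussian_def)
  have [measurable]: "\<phi> n \<in> borel_measurable M" for n
    by (rule centered_gaussian_measurable[OF M \<phi>])
  have sp: "space M = UNIV"
    using M sets_eq_imp_space_eq[of M borel] by (simp add: centered_gaussian_def)
  define S where "S y n = {x\<in>space M. \<forall>i<n. \<bar>\<phi> i x - \<phi> i y\<bar> \<le> t}" for y and n :: nat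
  have lim: "(\<lambda>n. measure M (S y n)) \<longlonglongrightarrow> measure M (cball y t)" for y
  proof -
    have "(\<Inter>n. S y n) = cball y t"
    proof -
      have "x \<in> cball y t \<longleftrightarrow> (\<forall>i. \<bar>\<phi> i x - \<phi> i y\<bar> \<le> t)" for x
        using norm[of "x - y" t] linear_diff[OF bounded_linear.linear[OF \<phi>]]
        by (simp add: dist_norm norm_minus_commute)
      moreover have "x \<in> (\<Inter>n. S y n) \<longleftrightarrow> (\<forall>i. \<bar>\<phi> i x - \<phi> i y\<bar> \<le> t)" for x
        by (auto simp: S_def sp intro: lessI)
      ultimately show ?thesis by blast
    qed
    moreover have "(\<lambda>n. measure M (S y n)) \<longlonglongrightarrow> measure M (\<Inter>n. S y n)"
      by (intro M.finite_Lim_measure_decseq) (auto simp: S_def decseq_def)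
    ultimately show ?thesis by simp
  qed
  have "measure M (S z n) \<le> measure M (S 0 n)" for n
    using anderson_cylinder[OF M \<phi>, where c = "\<lambda>i. \<phi> i z" and n = n and t = t]
      linear_0[OF bounded_linear.linear[OF \<phi>]]
    by (simp add: S_def)
  then show ?thesis by (intro LIMSEQ_le[OF lim lim]) auto
qed

section \<open>Quantizers of small distortion\<close>

lemma non_atomic_emeasure_singleton:
  assumes "non_atomic M" "{x} \<in> sets M"
  shows "emeasure M {x} = 0"
proof (rule ccontr)
  assume "emeasure M {x} \<noteq> 0"
  then obtain B where B: "B \<subseteq> {x}" "0 < emeasure M B" "emeasure M B < emeasure M {x}"
    using assms unfolding non_atomic_def by (auto simp: zero_less_iff_neq_zero)
  from B(1) have "B = {} \<or> B = {x}" by auto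
  then show False using B by auto
qed

text \<open>Each point has a ball of mass below \<epsilon>, and countably many of these cover the
  space. When they are added one by one inside \<open>B\<close>, the mass grows in steps below
  \<epsilon>, so it overshoots \<open>q\<close> by at most \<epsilon> when it first reaches
  it.\<close>

lemma exists_subset_of_mass:
  fixes M :: "'a::{metric_space, second_countable_topology} measure"
  assumes "prob_space M" and sets: "sets M = sets borel" and null: "\<And>x. emeasure M {x} = 0"
    and B: "B \<in> sets M" and q: "0 \<le> q" "q \<le> measure M B" and \<epsilon>: "\<epsilon> > 0"
  obtains A where "A \<in> sets M" "A \<subseteq> B" "q \<le> measure M A" "measure M A \<le> q + \<epsilon>"
\<comment> \<open>A value strictly below the mass of \<open>B\<close> is certain to be reached after
  finitely many balls; in the case of equality \<open>B\<close> itself serves.\<close>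
proof (cases "q = measure M B")
  case True
  then show ?thesis using that[of B] B \<epsilon> by simp
next
  case False
  interpret prob_space M by fact
  have [measurable]: "ball x d \<in> sets M" "{x} \<in> sets M" for x :: 'a and d by (auto simp: sets)
  have "\<exists>d>0. measure M (ball x d) < \<epsilon>" for x
  proof -
    have "(\<Inter>n. ball x (1 / real (Suc n))) = {x}"
    proof (intro equalityI subsetI)
      fix y assume "y \<in> (\<Inter>n. ball x (1 / real (Suc n)))"
      then have "dist x y < 1 / real (Suc n)" for n by simp
      then have "\<not> 0 < dist x y" using reals_Archimedean[of "dist x y"]
        by (metis inverse_eq_divide less_asym)
      then show "y \<in> {x}" by simp
    qed simp
    moreover have "(\<lambda>n. measure M (ball x (1 / real (Suc n)))) \<longlonglongrightarrow> measure M (\<Inter>n. ball x (1 / real (Suc n)))"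
    proof (rule finite_Lim_measure_decseq)
      show "decseq (\<lambda>n. ball x (1 / real (Suc n)))"
        unfolding decseq_def by (intro allI impI subset_ball frac_le) auto
    qed auto
    ultimately have "(\<lambda>n. measure M (ball x (1 / real (Suc n)))) \<longlonglongrightarrow> 0"
      using null[of x] by (simp add: measure_def)
    then have "\<forall>\<^sub>F n in sequentially. measure M (ball x (1 / real (Suc n))) < \<epsilon>"
      using \<epsilon> by (rule order_tendstoD(2))
    then obtain n where "measure M (ball x (1 / real (Suc n))) < \<epsilon>"
      by (auto simp: eventually_sequentially)
    then show ?thesis by (intro exI[of _ "1 / real (Suc n)"]) auto
  qed
  then obtain d where d: "\<And>x. d x > 0" "\<And>x. measure M (ball x (d x)) < \<epsilon>" by metis
  obtain F where F: "F \<subseteq> range (\<lambda>x. ball x (d x))" "countable F" "\<Union>F = \<Union>(range (\<lambda>x. ball x (d x)))"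
    using Lindelof[of "range (\<lambda>x. ball x (d x))"] by auto
  have "\<Union>F = UNIV" unfolding F(3) using d(1) by (auto intro: exI[of _ "_ :: 'a"])
  then have "F \<noteq> {}" by auto
  define U where "U = from_nat_into F"
  have U: "measure M (U n) < \<epsilon>" "U n \<in> sets M" for n
    using from_nat_into[OF \<open>F \<noteq> {}\<close>, of n] F(1) d(2) unfolding U_def by auto
  have UN: "(\<Union>n. U n) = UNIV"
    unfolding U_def using \<open>\<Union>F = UNIV\<close> range_from_nat_into[OF \<open>F \<noteq> {}\<close> F(2)] by simp
  define A where "A n = B \<inter> (\<Union>k<n. U k)" for n
  have A_sets[measurable]: "A n \<in> sets M" for n using B U by (auto simp: A_def)
  have "(\<lambda>n. measure M (A n)) \<longlonglongrightarrow> measure M (\<Union>n. A n)"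
  proof (rule finite_Lim_measure_incseq)
    show "incseq A"
      unfolding incseq_def A_def by (intro allI impI Int_mono UN_mono) auto
  qed (use A_sets in auto)
  also have "(\<Union>n. A n) = B" using UN by (fastforce simp: A_def)
  finally have "\<forall>\<^sub>F n in sequentially. q < measure M (A n)"
    using q(2) False by (intro order_tendstoD(1)[of _ "measure M B"]) auto
  then have ex: "\<exists>n. q \<le> measure M (A n)" by (auto simp: eventually_sequentially intro: less_imp_le)
  define n where "n = (LEAST n. q \<le> measure M (A n))"
  have n: "q \<le> measure M (A n)" unfolding n_def using ex by (rule LeastI_ex)
  have "measure M (A n) \<le> q + \<epsilon>"
  proof (cases n)
    case 0
    then show ?thesis using q \<epsilon> by (simp add: A_def)
  next
    case (Suc k)
    then have "measure M (A k) < q" using not_less_Least[of k "\<lambda>n. q \<le> measure M (A n)"] by (auto simp: n_def)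
    moreover have "measure M (A n) \<le> measure M (A k \<union> U k)"
    proof (rule finite_measure_mono)
      show "A n \<subseteq> A k \<union> U k" by (auto simp: A_def Suc less_Suc_eq)
      show "A k \<union> U k \<in> sets M" using U(2)[of k] A_sets[of k] by (rule sets.Un[rotated])
    qed
    moreover have "measure M (A k \<union> U k) \<le> measure M (A k) + measure M (U k)"
      by (intro measure_Un_le A_sets U(2))
    ultimately show ?thesis using U(1)[of k] by simp
  qed
  then show ?thesis using that[of "A n"] n by (auto simp: A_def intro: A_sets[unfolded A_def])
qed

text \<open>Mapping a point to the first member of a dense sequence within \<delta> is a measurable
  choice with countable range.\<close>

lemma exists_fine_quantizer:
  fixes \<delta> :: real
  assumes "\<delta> > 0"
  obtains h :: "'a::{metric_space, second_countable_topology} \<Rightarrow> 'a"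
  where "h \<in> quantizers" "\<And>x. dist x (h x) < \<delta>"
proof -
  obtain D :: "'a set" where D: "countable D" "\<And>X. open X \<Longrightarrow> X \<noteq> {} \<Longrightarrow> \<exists>d\<in>D. d \<in> X"
    using countable_dense_setE by blast
  have "D \<noteq> {}" using D(2)[of UNIV] by auto
  define d where "d = from_nat_into D"
  have ex: "\<exists>n. dist x (d n) < \<delta>" for x
  proof -
    obtain y where "y \<in> D" "y \<in> ball x \<delta>" using D(2)[of "ball x \<delta>"] assms by auto
    then show ?thesis using from_nat_into_surj[OF D(1)] unfolding d_def by fastforce
  qed
  define h where "h x = d (LEAST n. dist x (d n) < \<delta>)" for x
  have "h \<in> borel \<rightarrow>\<^sub>M borel" unfolding h_def by measurable
  moreover have "countable (range h)"
    by (rule countable_subset[of _ "range d"]) (auto simp: h_def)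
  moreover have "dist x (h x) < \<delta>" for x
    unfolding h_def using ex[of x] by (rule LeastI_ex)
  ultimately show ?thesis using that[of h] by (simp add: quantizers_def)
qed

section \<open>Cells and entropy of a quantizer\<close>

lemma quantizer_cell_sets:
  fixes f :: "'a::t1_space \<Rightarrow> 'a"
  assumes "f \<in> quantizers" "sets M = sets borel"
  shows "f -` {z} \<in> sets M"
proof -
  have "f -` {z} \<inter> space borel \<in> sets borel"
    using assms by (intro measurable_sets[of f borel borel]) (auto simp: quantizers_def)
  then show ?thesis using assms by simp
qed

lemma quantizer_cells_summable:
  fixes f :: "'a::t1_space \<Rightarrow> 'a"
  assumes "prob_space M" "sets M = sets borel" "f \<in> quantizers" "\<alpha> > 1"
  shows "(\<lambda>z. measure M (f -` {z}) powr \<alpha>) summable_on range f"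
proof (rule nonneg_bdd_above_summable_on)
  interpret prob_space M by fact
  note cell = quantizer_cell_sets[OF assms(3,2)]
  show "bdd_above (sum (\<lambda>z. measure M (f -` {z}) powr \<alpha>) ` {F. F \<subseteq> range f \<and> finite F})"
  proof (rule bdd_aboveI2)
    fix F assume "F \<in> {F. F \<subseteq> range f \<and> finite F}"
    then have "finite F" by simp
    have "measure M (f -` {z}) powr \<alpha> \<le> measure M (f -` {z})" for z
      using powr_mono'[of 1 \<alpha> "measure M (f -` {z})"] assms(4) by (simp add: measure_nonneg)
    then have "(\<Sum>z\<in>F. measure M (f -` {z}) powr \<alpha>) \<le> (\<Sum>z\<in>F. measure M (f -` {z}))"
      by (intro sum_mono)
    also have "\<dots> = measure M (\<Union>z\<in>F. f -` {z})"
      using \<open>finite F\<close> cell by (intro finite_measure_finite_Union[symmetric]) (auto simp: disjoint_family_on_def)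
    also have "\<dots> \<le> 1" by simp
    finally show "(\<Sum>z\<in>F. measure M (f -` {z}) powr \<alpha>) \<le> 1" .
  qed
qed simp

text \<open>Countably many null cells cannot cover the space. Positivity keeps the logarithm in the
  entropy meaningful.\<close>

lemma quantizer_sum_pos:
  fixes f :: "'a::t1_space \<Rightarrow> 'a"
  assumes "prob_space M" "sets M = sets borel" "f \<in> quantizers" "\<alpha> > 1"
  shows "0 < (\<Sum>\<^sub>\<infinity>z\<in>range f. measure M (f -` {z}) powr \<alpha>)"
proof -
  interpret prob_space M by fact
  note cell = quantizer_cell_sets[OF assms(3,2)]
  have "\<exists>z\<in>range f. measure M (f -` {z}) \<noteq> 0"
  proof (rule ccontr)
    assume "\<not> ?thesis"
    then have "f -` {z} \<in> null_sets M" if "z \<in> range f" for z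
      using that cell by (auto simp: null_sets_def emeasure_eq_measure)
    then have "(\<Union>z\<in>range f. f -` {z}) \<in> null_sets M"
      using assms(3) by (intro null_sets_UN') (auto simp: quantizers_def)
    moreover have "(\<Union>z\<in>range f. f -` {z}) = space M"
      using sets_eq_imp_space_eq[OF assms(2)] by auto
    ultimately show False using emeasure_space_1 by auto
  qed
  then obtain z where z: "z \<in> range f" "measure M (f -` {z}) \<noteq> 0" by blast
  then have "0 < (\<Sum>z\<in>{z}. measure M (f -` {z}) powr \<alpha>)" by simp
  also have "\<dots> \<le> (\<Sum>\<^sub>\<infinity>z\<in>range f. measure M (f -` {z}) powr \<alpha>)"
    using z by (intro finite_sum_le_infsum quantizer_cells_summable[OF assms]) auto
  finally show ?thesis .
qed

text \<open>The factor 1 / (1 - \<alpha>) is negative, so an upper bound on the entropy becomes a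
  lower bound on the sum.\<close>

lemma renyi_entropy_le_iff:
  fixes f :: "'a::t1_space \<Rightarrow> 'a"
  assumes "prob_space M" "sets M = sets borel" "f \<in> quantizers" "\<alpha> > 1"
  shows "renyi_entropy M \<alpha> f \<le> R \<longleftrightarrow>
    exp (- ((\<alpha> - 1) * R)) \<le> (\<Sum>\<^sub>\<infinity>z\<in>range f. measure M (f -` {z}) powr \<alpha>)"
proof -
  define S where "S = (\<Sum>\<^sub>\<infinity>z\<in>range f. measure M (f -` {z}) powr \<alpha>)"
  have "S > 0" unfolding S_def by (rule quantizer_sum_pos[OF assms])
  have "renyi_entropy M \<alpha> f \<le> R \<longleftrightarrow> - ((\<alpha> - 1) * R) \<le> ln S"
    using assms(4) by (simp add: renyi_entropy_def S_def[symmetric] divide_simps) (simp add: algebra_simps)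
  also have "\<dots> \<longleftrightarrow> exp (- ((\<alpha> - 1) * R)) \<le> S"
    using \<open>S > 0\<close> by (simp add: ln_ge_iff)
  finally show ?thesis by (simp add: S_def)
qed

text \<open>The set sent to 0 is a part of the ball with mass at least, but hardly above,
  exp(-\<rho>): the ball itself may be much heavier and would then cost too much. Outside this set
  the cost is arbitrarily small.\<close>

lemma INF_distortion_le:
  fixes M :: "'a::{real_normed_vector, second_countable_topology} measure"
  assumes M: "prob_space M" "sets M = sets borel" and na: "non_atomic M"
    and r: "r > 0" and \<alpha>: "\<alpha> > 1" and s: "s > 0"
    and \<rho>: "\<rho> = (\<alpha> - 1) / \<alpha> * R" and mass: "exp (- \<rho>) \<le> measure M (cball 0 s)"
  shows "(INF f\<in>{f \<in> quantizers. renyi_entropy M \<alpha> f \<le> R}. distortion M r f) \<le> ennreal (s powr r * exp (- \<rho>))"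
proof (rule ennreal_le_epsilon)
  interpret prob_space M by fact
  fix e :: real assume e: "e > 0"
  \<comment> \<open>\<open>\<delta>\<close> and \<open>\<epsilon>\<close> are chosen such that the
    fine quantization and the excess mass of \<open>A\<close> each cost at most e / 2.\<close>
  define \<delta> where "\<delta> = (e / 2) powr (1 / r)"
  have \<delta>: "\<delta> > 0" "\<delta> powr r = e / 2" using e r by (simp_all add: \<delta>_def powr_powr)
  define \<epsilon> where "\<epsilon> = e / 2 / s powr r"
  have \<epsilon>: "\<epsilon> > 0" "s powr r * \<epsilon> = e / 2" using e s by (simp_all add: \<epsilon>_def)
  obtain A where A[measurable]: "A \<in> sets M" and AB: "A \<subseteq> cball 0 s"
    and A_mass: "exp (- \<rho>) \<le> measure M A" "measure M A \<le> exp (- \<rho>) + \<epsilon>"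
  proof (rule exists_subset_of_mass[OF M _ _ _ mass \<epsilon>(1)])
    show "emeasure M {x} = 0" for x by (rule non_atomic_emeasure_singleton[OF na]) (simp add: M)
    show "cball 0 s \<in> sets M" by (simp add: M)
  qed simp
  obtain h :: "'a \<Rightarrow> 'a" where h: "h \<in> quantizers" "\<And>x. dist x (h x) < \<delta>"
    using exists_fine_quantizer[OF \<delta>(1)] by blast
  define f where "f x = (if x \<in> A then 0 else h x)" for x
  have "f \<in> borel \<rightarrow>\<^sub>M borel"
    unfolding f_def using A h(1) M(2) by (intro measurable_If_set) (auto simp: quantizers_def)
  moreover have "countable (range f)"
    by (rule countable_subset[of _ "insert 0 (range h)"])
      (use h(1) in \<open>auto simp: f_def quantizers_def\<close>)
  ultimately have f: "f \<in> quantizers" by (simp add: quantizers_def)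
  have "A \<noteq> {}" using A_mass(1) by (metis exp_gt_zero measure_empty not_le)
  then obtain y where "y \<in> A" by blast
  then have f0: "0 \<in> range f" by (intro range_eqI[of _ _ y]) (simp add: f_def)
  \<comment> \<open>Since (\<alpha> - 1) R = \<alpha> \<rho>, the required sum is the \<alpha>-th
    power of the mass exp(-\<rho>).\<close>
  have "exp (- ((\<alpha> - 1) * R)) = exp (- \<rho>) powr \<alpha>"
    using \<alpha> by (simp add: powr_def \<rho>)
  also have "\<dots> \<le> measure M A powr \<alpha>"
    using \<alpha> A_mass by (intro powr_mono2) auto
  \<comment> \<open>Only an inequality, as \<open>h\<close> may take the value 0 too and enlarge the
    cell of 0 beyond \<open>A\<close>.\<close>
  also have "\<dots> \<le> (\<Sum>z\<in>{0}. measure M (f -` {z}) powr \<alpha>)"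
    using \<alpha> quantizer_cell_sets[OF f M(2), of 0]
    by (auto intro!: powr_mono2 finite_measure_mono simp: f_def)
  also have "\<dots> \<le> (\<Sum>\<^sub>\<infinity>z\<in>range f. measure M (f -` {z}) powr \<alpha>)"
    using f0 by (intro finite_sum_le_infsum quantizer_cells_summable[OF M f \<alpha>]) auto
  finally have H: "renyi_entropy M \<alpha> f \<le> R" by (simp add: renyi_entropy_le_iff[OF M f \<alpha>])
  have "(INF f\<in>{f \<in> quantizers. renyi_entropy M \<alpha> f \<le> R}. distortion M r f) \<le> distortion M r f"
    using f H by (intro INF_lower) auto
  also have "\<dots> \<le> (\<integral>\<^sup>+x. ennreal (s powr r) * indicator A x + ennreal (\<delta> powr r) \<partial>M)"
    unfolding distortion_def
  proof (rule nn_integral_mono)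
    fix x
    show "ennreal (norm (x - f x) powr r) \<le> ennreal (s powr r) * indicator A x + ennreal (\<delta> powr r)"
    proof (cases "x \<in> A")
      case True
      then have "norm (x - f x) powr r \<le> s powr r" using AB r by (intro powr_mono2) (auto simp: f_def)
      then show ?thesis using True by (auto intro!: add_increasing2 ennreal_leI)
    next
      case False
      then have "norm (x - f x) powr r \<le> \<delta> powr r"
        using h(2)[of x] r by (intro powr_mono2) (auto simp: f_def dist_norm)
      then show ?thesis using False by (auto intro!: ennreal_leI)
    qed
  qed
  also have "\<dots> = ennreal (s powr r) * emeasure M A + ennreal (\<delta> powr r)"
    by (subst nn_integral_add) (auto simp: nn_integral_cmult_indicator emeasure_space_1)
  also have "\<dots> = ennreal (s powr r * measure M A + \<delta> powr r)"
    by (simp add: emeasure_eq_measure ennreal_mult)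
  also have "\<dots> \<le> ennreal (s powr r * (exp (- \<rho>) + \<epsilon>) + \<delta> powr r)"
    using A_mass by (intro ennreal_leI add_mono mult_left_mono) auto
  also have "\<dots> = ennreal (s powr r * exp (- \<rho>)) + ennreal e"
    using \<delta> \<epsilon> e by (simp add: distrib_left ennreal_plus[symmetric] del: ennreal_plus)
  finally show "(INF f\<in>{f \<in> quantizers. renyi_entropy M \<alpha> f \<le> R}. distortion M r f)
      \<le> ennreal (s powr r * exp (- \<rho>)) + ennreal e" .
qed

section \<open>Lower bound for the distortion\<close>

text \<open>Points of the cell outside the ball of radius \<tau> around \<open>z\<close> have error
  above \<tau>, and Anderson's inequality bounds the mass of that ball uniformly in
  \<open>z\<close>. If the difference of masses is negative, \<open>ennreal\<close> sends the left
  side to 0.\<close>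

lemma cell_distortion_ge:
  fixes M :: "'a::{real_normed_vector, second_countable_topology} measure"
  assumes M: "centered_gaussian M" and f: "f \<in> quantizers" and r: "r > 0" and \<tau>: "\<tau> \<ge> 0"
  shows "ennreal (\<tau> powr r * (measure M (f -` {z}) - measure M (cball 0 \<tau>)))
    \<le> (\<integral>\<^sup>+x. ennreal (norm (x - f x) powr r) * indicator (f -` {z}) x \<partial>M)"
proof -
  have sets: "sets M = sets borel" using M by (simp add: centered_gaussian_def)
  interpret prob_space M using M by (simp add: centered_gaussian_def)
  have [measurable]: "f -` {z} \<in> sets M" by (rule quantizer_cell_sets[OF f sets])
  have [measurable]: "cball z \<tau> \<in> sets M" by (simp add: sets)
  have "measure M (f -` {z}) - measure M (cball 0 \<tau>) \<le> measure M (f -` {z}) - measure M (cball z \<tau>)"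
    using anderson_cball[OF M, of z \<tau>] by simp
  also have "\<dots> \<le> measure M (f -` {z} - cball z \<tau>)"
    using measure_Un_le[of "f -` {z} - cball z \<tau>" M "cball z \<tau>"]
      finite_measure_mono[of "f -` {z}" "(f -` {z} - cball z \<tau>) \<union> cball z \<tau>"] by fastforce
  finally have "ennreal (\<tau> powr r * (measure M (f -` {z}) - measure M (cball 0 \<tau>)))
      \<le> ennreal (\<tau> powr r * measure M (f -` {z} - cball z \<tau>))"
    by (intro ennreal_leI mult_left_mono) auto
  also have "\<dots> = (\<integral>\<^sup>+x. ennreal (\<tau> powr r) * indicator (f -` {z} - cball z \<tau>) x \<partial>M)"
    by (simp add: nn_integral_cmult_indicator emeasure_eq_measure ennreal_mult)
  also have "\<dots> \<le> (\<integral>\<^sup>+x. ennreal (norm (x - f x) powr r) * indicator (f -` {z}) x \<partial>M)"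
    using r \<tau> by (intro nn_integral_mono)
      (auto simp: indicator_def dist_norm norm_minus_commute intro!: ennreal_leI powr_mono2)
  finally show ?thesis .
qed

text \<open>Distinct cells are disjoint, so their indicators add up to at most 1.\<close>

lemma sum_cell_distortion_le:
  fixes M :: "'a::{real_normed_vector, second_countable_topology} measure"
  assumes sets: "sets M = sets borel" and f: "f \<in> quantizers" and F: "finite F"
  shows "(\<Sum>z\<in>F. \<integral>\<^sup>+x. ennreal (norm (x - f x) powr r) * indicator (f -` {z}) x \<partial>M) \<le> distortion M r f"
proof -
  have [measurable]: "f \<in> borel_measurable M"
    using f sets by (simp add: quantizers_def cong: measurable_cong_sets)
  have [measurable]: "f -` {z} \<in> sets M" for z by (rule quantizer_cell_sets[OF f sets])
  have [measurable]: "(\<lambda>x. x) \<in> borel_measurable M" using sets by (simp cong: measurable_cong_sets)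
  have ind: "(\<Sum>z\<in>F. indicator (f -` {z}) x) \<le> (1::ennreal)" for x
  proof -
    have "(\<Sum>z\<in>F. indicator (f -` {z}) x) = (\<Sum>z\<in>F. if f x = z then 1 else (0::ennreal))"
      by (intro sum.cong) (auto simp: indicator_def)
    then show ?thesis using F by simp
  qed
  have "(\<Sum>z\<in>F. \<integral>\<^sup>+x. ennreal (norm (x - f x) powr r) * indicator (f -` {z}) x \<partial>M)
      = (\<integral>\<^sup>+x. ennreal (norm (x - f x) powr r) * (\<Sum>z\<in>F. indicator (f -` {z}) x) \<partial>M)"
    by (subst nn_integral_sum[symmetric]) (auto simp: sum_distrib_left)
  also have "\<dots> \<le> distortion M r f"
    unfolding distortion_def using ind by (intro nn_integral_mono) (metis mult.right_neutral mult_left_mono zero_le)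
  finally show ?thesis .
qed

text \<open>Monotonicity of \<open>\<tau>(x)\<^sup>r exp((\<alpha> - 1) x)\<close> makes the bound for a cell of mass \<open>p < exp(-\<rho>)\<close>
  proportional to \<open>p\<^sup>\<alpha>\<close>, so that the entropy constraint can be summed over the cells.\<close>

lemma distortion_ge:
  fixes M :: "'a::{real_normed_vector, second_countable_topology} measure"
  assumes M: "centered_gaussian M" and f: "f \<in> quantizers" and r: "r > 0" and \<alpha>: "\<alpha> > 1"
    and H: "renyi_entropy M \<alpha> f \<le> R" and \<rho>: "\<rho> = (\<alpha> - 1) / \<alpha> * R"
    and \<epsilon>: "0 < \<epsilon>" "\<epsilon> < 1"
    and \<tau>: "\<And>x. x \<ge> \<rho> \<Longrightarrow> \<tau> x > 0"
    and small: "\<And>x. x \<ge> \<rho> \<Longrightarrow> measure M (cball 0 (\<tau> x)) \<le> \<epsilon> * exp (- x)"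
    and mono: "\<And>x. x \<ge> \<rho> \<Longrightarrow> \<tau> \<rho> powr r * exp ((\<alpha> - 1) * \<rho>) \<le> \<tau> x powr r * exp ((\<alpha> - 1) * x)"
  shows "ennreal ((1 - \<epsilon>) * \<tau> \<rho> powr r * exp (- \<rho>)) \<le> distortion M r f"
proof -
  have sets: "sets M = sets borel" and P: "prob_space M" using M by (simp_all add: centered_gaussian_def)
  interpret prob_space M by fact
  let ?m = "\<lambda>z. measure M (f -` {z})"
  let ?D = "\<lambda>z. \<integral>\<^sup>+x. ennreal (norm (x - f x) powr r) * indicator (f -` {z}) x \<partial>M"
  note cell = cell_distortion_ge[OF M f r]
  note sum_le = sum_cell_distortion_le[where r = r, OF sets f]
  show ?thesis
  \<comment> \<open>A cell this heavy suffices alone. Otherwise every positive cell mass is exp(-x)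
    with \<open>x \<ge> \<rho>\<close>, the range of the hypotheses on
    \<open>\<tau>\<close>.\<close>
  proof (cases "\<exists>z. ?m z \<ge> exp (- \<rho>)")
    case True
    then obtain z where z: "?m z \<ge> exp (- \<rho>)" by blast
    have "(1 - \<epsilon>) * \<tau> \<rho> powr r * exp (- \<rho>) = \<tau> \<rho> powr r * (exp (- \<rho>) - \<epsilon> * exp (- \<rho>))"
      by (simp add: algebra_simps)
    also have "\<dots> \<le> \<tau> \<rho> powr r * (?m z - measure M (cball 0 (\<tau> \<rho>)))"
      using z small[of \<rho>] by (intro mult_left_mono) auto
    finally have le: "(1 - \<epsilon>) * \<tau> \<rho> powr r * exp (- \<rho>) \<le> \<tau> \<rho> powr r * (?m z - measure M (cball 0 (\<tau> \<rho>)))" .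
    have "ennreal ((1 - \<epsilon>) * \<tau> \<rho> powr r * exp (- \<rho>)) \<le> ?D z"
      by (rule order_trans[OF ennreal_leI[OF le] cell]) (use \<tau>[of \<rho>] in simp)
    also have "\<dots> \<le> distortion M r f" using sum_le[of "{z}"] by simp
    finally show ?thesis .
  next
    case False
    define L where "L = \<tau> \<rho> powr r * exp ((\<alpha> - 1) * \<rho>)"
    have L: "L > 0" using \<tau>[of \<rho>] by (simp add: L_def)
    have cell_L: "ennreal ((1 - \<epsilon>) * L * ?m z powr \<alpha>) \<le> ?D z" for z
    proof (cases "?m z = 0")
      case False
      define x where "x = - ln (?m z)"
      have m: "?m z > 0" "?m z = exp (- x)" using False by (simp_all add: x_def zero_less_measure_iff)
      have "exp (- x) < exp (- \<rho>)" using \<open>\<not> (\<exists>z. ?m z \<ge> exp (- \<rho>))\<close> m by (metis not_le)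
      then have x: "x \<ge> \<rho>" by simp
      have "(1 - \<epsilon>) * L * ?m z powr \<alpha> \<le> (1 - \<epsilon>) * (\<tau> x powr r * exp ((\<alpha> - 1) * x)) * ?m z powr \<alpha>"
        using mono[OF x] \<epsilon> by (intro mult_right_mono mult_left_mono) (auto simp: L_def)
      also have "\<dots> = \<tau> x powr r * ((1 - \<epsilon>) * exp (- x))"
      proof -
        \<comment> \<open>The exponential factor turns the \<alpha>-th power of the mass back into
          the mass itself.\<close>
        have "exp ((\<alpha> - 1) * x) * ?m z powr \<alpha> = exp (- x)"
          unfolding m(2) by (simp add: powr_def exp_add[symmetric] algebra_simps)
        then show ?thesis by (metis (no_types, lifting) mult.assoc mult.commute)
      qed
      also have "\<dots> \<le> \<tau> x powr r * (?m z - measure M (cball 0 (\<tau> x)))"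
        using small[OF x] m(2) by (intro mult_left_mono) (auto simp: algebra_simps)
      finally have le: "(1 - \<epsilon>) * L * ?m z powr \<alpha> \<le> \<tau> x powr r * (?m z - measure M (cball 0 (\<tau> x)))" .
      show ?thesis
        by (rule order_trans[OF ennreal_leI[OF le] cell]) (use \<tau>[OF x] in simp)
    qed (use \<alpha> in simp)
    show ?thesis
    \<comment> \<open>Infinite distortion is trivial; a finite one bounds all finite partial sums
      and hence the entropy sum.\<close>
    proof (cases "distortion M r f")
      case (real D)
      have "(\<Sum>z\<in>F. ?m z powr \<alpha>) \<le> D / ((1 - \<epsilon>) * L)" if F: "finite F" for F
      proof -
        have "ennreal ((1 - \<epsilon>) * L * (\<Sum>z\<in>F. ?m z powr \<alpha>)) = (\<Sum>z\<in>F. ennreal ((1 - \<epsilon>) * L * ?m z powr \<alpha>))"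
          using \<epsilon> L by (simp add: sum_ennreal sum_distrib_left)
        also have "\<dots> \<le> (\<Sum>z\<in>F. ?D z)" by (intro sum_mono cell_L)
        also have "\<dots> \<le> ennreal D" using sum_le[OF F] real by simp
        finally have "(1 - \<epsilon>) * L * (\<Sum>z\<in>F. ?m z powr \<alpha>) \<le> D" using real by (simp add: ennreal_le_iff)
        then show ?thesis using \<epsilon> L by (simp add: field_simps)
      qed
      then have "(\<Sum>\<^sub>\<infinity>z\<in>range f. ?m z powr \<alpha>) \<le> D / ((1 - \<epsilon>) * L)"
        by (intro infsum_le_finite_sums quantizer_cells_summable[OF P sets f \<alpha>]) auto
      then have "exp (- ((\<alpha> - 1) * R)) \<le> D / ((1 - \<epsilon>) * L)"
        using H by (simp add: renyi_entropy_le_iff[OF P sets f \<alpha>])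
      then have "(1 - \<epsilon>) * L * exp (- ((\<alpha> - 1) * R)) \<le> D"
        using \<epsilon> L by (simp add: field_simps)
      moreover have "(\<alpha> - 1) * R = \<alpha> * \<rho>" using \<alpha> by (simp add: \<rho>)
      moreover have "exp ((\<alpha> - 1) * \<rho>) * exp (- (\<alpha> * \<rho>)) = exp (- \<rho>)"
        by (simp add: exp_add[symmetric] algebra_simps)
      ultimately have "(1 - \<epsilon>) * \<tau> \<rho> powr r * exp (- \<rho>) \<le> D"
        by (simp add: L_def mult.assoc)
      then show ?thesis using real by (simp add: ennreal_leI)
    qed simp
  qed
qed

section \<open>Asymptotics\<close>

text \<open>For positive \<open>c\<close> and \<open>a\<close>, an asymptotic inverse of the
  function c (1/s)^a (ln (1/s))^b of s: substituting it for s gives a quantity equivalent to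
  \<open>x\<close> as \<open>x\<close> tends to infinity.\<close>

definition small_ball_inverse :: "real \<Rightarrow> real \<Rightarrow> real \<Rightarrow> real \<Rightarrow> real" where
  "small_ball_inverse c a b x = c powr (1 / a) * a powr (- b / a) * x powr (- 1 / a) * ln x powr (b / a)"

lemma small_ball_inverse_pos:
  assumes "c > 0" "a > 0" "x > 1"
  shows "small_ball_inverse c a b x > 0"
  using assms by (simp add: small_ball_inverse_def)

lemma ln_small_ball_inverse:
  assumes "c > 0" "a > 0" "x > 1"
  shows "ln (small_ball_inverse c a b x)
    = (1 / a) * ln c - (b / a) * ln a - (1 / a) * ln x + (b / a) * ln (ln x)"
  using assms by (simp add: small_ball_inverse_def ln_mult ln_powr)

text \<open>Up to a constant and a multiple of ln (ln x), the logarithm of the asymptotic inverse is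
  -(1/a) ln x; the factor \<open>k\<close> only alters the constant.\<close>

lemma tendsto_ln_inverse_small_ball_inverse:
  assumes "c > 0" "a > 0" "k > 0"
  shows "((\<lambda>x. ln (1 / (k * small_ball_inverse c a b x)) / ln x) \<longlongrightarrow> 1 / a) at_top"
proof -
  have "((\<lambda>x. (b / a * ln a - ln k - 1 / a * ln c) / ln x + 1 / a - b / a * (ln (ln x) / ln x)) \<longlongrightarrow> 0 + 1 / a - b / a * 0) at_top"
  proof (intro tendsto_intros)
    show "((\<lambda>x. (b / a * ln a - ln k - 1 / a * ln c) / ln x) \<longlongrightarrow> 0) at_top"
      by (rule real_tendsto_divide_at_top[OF tendsto_const ln_at_top])
    show "((\<lambda>x::real. ln (ln x) / ln x) \<longlongrightarrow> 0) at_top" by real_asymp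
  qed
  moreover have "\<forall>\<^sub>F x in at_top. (b / a * ln a - ln k - 1 / a * ln c) / ln x + 1 / a - b / a * (ln (ln x) / ln x)
      = ln (1 / (k * small_ball_inverse c a b x)) / ln x"
    using eventually_gt_at_top[of 1]
  proof eventually_elim
    case (elim x)
    have "ln (1 / (k * small_ball_inverse c a b x)) = - ln k - ln (small_ball_inverse c a b x)"
      using small_ball_inverse_pos[OF assms(1,2) elim, of b] assms(3) by (simp add: ln_div ln_mult)
    then show ?case using elim unfolding ln_small_ball_inverse[OF assms(1,2) elim]
      by (simp add: diff_divide_distrib add_divide_distrib)
  qed
  ultimately show ?thesis by (simp add: tendsto_cong)
qed

text \<open>The preceding limit is positive, so the logarithm of the reciprocal diverges;
  exponentiating gives convergence to 0 from the right.\<close>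

lemma filterlim_small_ball_inverse:
  assumes "c > 0" "a > 0" "k > 0"
  shows "filterlim (\<lambda>x. k * small_ball_inverse c a b x) (at_right 0) at_top"
proof -
  have "filterlim (\<lambda>x. ln (1 / (k * small_ball_inverse c a b x)) / ln x * ln x) at_top at_top"
    using assms by (intro filterlim_tendsto_pos_mult_at_top[OF tendsto_ln_inverse_small_ball_inverse _ ln_at_top]) auto
  then have "filterlim (\<lambda>x. ln (1 / (k * small_ball_inverse c a b x))) at_top at_top"
    by (rule filterlim_mono_eventually[OF _ order_refl order_refl])
      (use eventually_gt_at_top[of "1::real"] in \<open>eventually_elim, simp\<close>)
  then have "filterlim (\<lambda>x. exp (ln (1 / (k * small_ball_inverse c a b x)))) at_top at_top"
    by (rule filterlim_compose[OF exp_at_top])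
  then have "filterlim (\<lambda>x. inverse (exp (ln (1 / (k * small_ball_inverse c a b x))))) (at_right 0) at_top"
    by (rule filterlim_compose[OF filterlim_inverse_at_right_top])
  then show ?thesis
  proof (rule filterlim_mono_eventually[OF _ order_refl order_refl])
    show "\<forall>\<^sub>F x in at_top. inverse (exp (ln (1 / (k * small_ball_inverse c a b x)))) = k * small_ball_inverse c a b x"
      using eventually_gt_at_top[of 1]
    proof eventually_elim
      case (elim x)
      have "0 < 1 / (k * small_ball_inverse c a b x)"
        using small_ball_inverse_pos[OF assms(1,2) elim, of b] assms(3) by simp
      then show ?case by (simp only: exp_ln) simp
    qed
  qed
qed

text \<open>Scaling the radius by \<open>k\<close> multiplies the leading term by k^(-a). The
  logarithm of the reciprocal radius is asymptotic to ln x / a, and the factor a^(-b/a) in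
  \<open>small_ball_inverse\<close> cancels the resulting power of \<open>a\<close>. For
  \<open>k\<close> different from 1 the limit differs from 1, which leaves room for strict
  comparisons.\<close>

lemma tendsto_small_ball_fun_inverse:
  assumes "c > 0" "a > 0" "k > 0"
    and equiv: "B \<sim>[at_right 0] (\<lambda>s. c * (1 / s) powr a * ln (1 / s) powr b)"
  shows "((\<lambda>x. B (k * small_ball_inverse c a b x) / x) \<longlongrightarrow> k powr (- a)) at_top"
proof -
  let ?s = "\<lambda>x. k * small_ball_inverse c a b x"
  let ?G = "\<lambda>s. c * (1 / s) powr a * ln (1 / s) powr b"
  have "((\<lambda>x. k powr (- a) * a powr b * (ln (1 / ?s x) / ln x) powr b)
      \<longlongrightarrow> k powr (- a) * a powr b * (1 / a) powr b) at_top"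
    using assms by (intro tendsto_intros tendsto_ln_inverse_small_ball_inverse) auto
  moreover have "k powr (- a) * a powr b * (1 / a) powr b = k powr (- a)"
    using assms by (simp add: powr_divide)
  moreover have "\<forall>\<^sub>F x in at_top. k powr (- a) * a powr b * (ln (1 / ?s x) / ln x) powr b = ?G (?s x) / x"
  proof -
    have "\<forall>\<^sub>F x in at_top. 0 < ln (1 / ?s x) / ln x"
      using assms by (intro order_tendstoD(1)[OF tendsto_ln_inverse_small_ball_inverse]) auto
    then show ?thesis using eventually_gt_at_top[of 1]
    proof eventually_elim
      case (elim x)
      then have x: "x > 1" and l: "ln (1 / ?s x) > 0" by (auto simp: zero_less_divide_iff dest: ln_gt_zero)
      have p: "small_ball_inverse c a b x > 0" using assms x by (intro small_ball_inverse_pos)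
      have "small_ball_inverse c a b x powr a = c * a powr (- b) * x powr (- 1) * ln x powr b"
        using assms x by (simp add: small_ball_inverse_def powr_mult powr_powr)
      then have q: "(1 / ?s x) powr a = k powr (- a) * (a powr b * x / (c * ln x powr b))"
        using assms x p by (simp add: powr_divide powr_mult powr_minus field_simps)
      define L where "L = ln (1 / ?s x)"
      show ?case
        unfolding q L_def[symmetric] using assms x l[folded L_def]
        by (simp add: powr_divide field_simps)
    qed
  qed
  ultimately have G: "((\<lambda>x. ?G (?s x) / x) \<longlongrightarrow> k powr (- a)) at_top"
    by (simp add: tendsto_cong)
  have "(\<lambda>x. B (?s x)) \<sim>[at_top] (\<lambda>x. ?G (?s x))"
    using equiv by (rule asymp_equiv_compose') (rule filterlim_small_ball_inverse[OF assms(1-3)])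
  then have "(\<lambda>x. B (?s x) / x) \<sim>[at_top] (\<lambda>x. ?G (?s x) / x)"
    by (intro asymp_equiv_intros)
  then show ?thesis by (rule tendsto_asymp_equiv_cong[THEN iffD2]) (rule G)
qed

text \<open>The logarithm of the expression has a derivative tending to \<kappa> > 0, as the power
  of the asymptotic inverse contributes only terms of order 1/x.\<close>

lemma small_ball_inverse_exp_mono:
  assumes "c > 0" "a > 0" "r > 0" "\<kappa> > 0"
  shows "\<exists>X>1. \<forall>x\<ge>X. \<forall>y\<ge>x. small_ball_inverse c a b x powr r * exp (\<kappa> * x)
    \<le> small_ball_inverse c a b y powr r * exp (\<kappa> * y)"
proof -
  define u where "u x = r * ((1 / a) * ln c - (b / a) * ln a - (1 / a) * ln x + (b / a) * ln (ln x)) + \<kappa> * x" for x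
  define u' where "u' x = r * (- (1 / a) * (1 / x) + (b / a) * (1 / (x * ln x))) + \<kappa>" for x
  have "((\<lambda>x. u' x) \<longlongrightarrow> r * (- (1 / a) * 0 + (b / a) * 0) + \<kappa>) at_top"
    unfolding u'_def
  proof (intro tendsto_intros)
    show "((\<lambda>x::real. 1 / x) \<longlongrightarrow> 0) at_top" "((\<lambda>x::real. 1 / (x * ln x)) \<longlongrightarrow> 0) at_top" by real_asymp+
  qed
  from order_tendstoD(1)[OF this, of 0] have "\<forall>\<^sub>F x in at_top. 0 < u' x" using assms by simp
  then obtain X0 where X0: "\<And>x. x \<ge> X0 \<Longrightarrow> 0 < u' x" by (auto simp: eventually_at_top_linorder)
  \<comment> \<open>The lower bound 2 keeps \<open>x > 1\<close>, where ln x is positive and the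
    formulas for the logarithm and its derivative are valid.\<close>
  define X where "X = max X0 2"
  have der: "(u has_real_derivative u' x) (at x)" if "x > 1" for x
    unfolding u_def u'_def using that assms
    by (auto intro!: derivative_eq_intros simp: field_simps)
  have eq: "small_ball_inverse c a b x powr r * exp (\<kappa> * x) = exp (u x)" if "x > 1" for x
    using small_ball_inverse_pos[OF assms(1,2) that, of b] ln_small_ball_inverse[OF assms(1,2) that, of b]
    by (simp add: powr_def u_def exp_add)
  have "u x \<le> u y" if "X \<le> x" "x \<le> y" for x y
  proof (rule DERIV_nonneg_imp_nondecreasing[OF that(2)])
    fix t assume "x \<le> t" "t \<le> y"
    then show "\<exists>d. (u has_real_derivative d) (at t) \<and> 0 \<le> d"
      using that der[of t] X0[of t] by (intro exI[of _ "u' t"]) (auto simp: X_def)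
  qed
  then show ?thesis by (intro exI[of _ X]) (auto simp: X_def eq)
qed

section \<open>Two-sided bounds for the optimal distortion\<close>

context
  fixes M :: "'a::{banach, second_countable_topology} measure" and r \<alpha> c a b :: real
  assumes M: "centered_gaussian M" and na: "non_atomic M"
    and r: "r > 0" and \<alpha>: "\<alpha> > 1" and c: "c > 0" and a: "a > 0"
    and equiv: "small_ball_fun M \<sim>[at_right 0] (\<lambda>s. c * (1 / s) powr a * ln (1 / s) powr b)"
begin

text \<open>Enlarging the radius makes the limit (1 + \<epsilon>)^(-a) of the small ball function
  divided by \<open>x\<close> smaller than 1.\<close>

lemma eventually_small_ball_ge:
  assumes "\<epsilon> > 0"
  shows "\<forall>\<^sub>F x in at_top. exp (- x) \<le> measure M (cball 0 ((1 + \<epsilon>) * small_ball_inverse c a b x))"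
proof -
  have lim: "((\<lambda>x. small_ball_fun M ((1 + \<epsilon>) * small_ball_inverse c a b x) / x) \<longlongrightarrow> (1 + \<epsilon>) powr (- a)) at_top"
    using assms c a equiv by (intro tendsto_small_ball_fun_inverse) auto
  have "(1 + \<epsilon>) powr (- a) < 1" "0 < (1 + \<epsilon>) powr (- a)" using assms a by (simp_all add: powr_less_one)
  from order_tendstoD(2)[OF lim this(1)] order_tendstoD(1)[OF lim this(2)] eventually_gt_at_top[of 0]
  show ?thesis
  proof (eventually_elim)
    case (elim x)
    let ?m = "measure M (cball 0 ((1 + \<epsilon>) * small_ball_inverse c a b x))"
    have "0 < - ln ?m" "- ln ?m < x"
      using elim by (auto simp: small_ball_fun_def divide_simps zero_less_divide_iff split: if_splits)
    \<comment> \<open>Since \<open>ln 0\<close> is 0, the strict lower bound on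
      \<open>- ln ?m\<close> excludes mass zero.\<close>
    then have "?m \<noteq> 0" by auto
    then have "?m > 0" by (simp add: zero_less_measure_iff)
    then show ?case using \<open>- ln ?m < x\<close> by (simp add: ln_ge_iff[symmetric])
  qed
qed

text \<open>Shrinking the radius makes the limit (1 - \<epsilon>)^(-a) exceed 1, and the surplus,
  linear in \<open>x\<close>, absorbs the constant \<open>- ln \<epsilon>\<close>.\<close>

lemma eventually_small_ball_le:
  assumes "0 < \<epsilon>" "\<epsilon> < 1"
  shows "\<forall>\<^sub>F x in at_top. measure M (cball 0 ((1 - \<epsilon>) * small_ball_inverse c a b x)) \<le> \<epsilon> * exp (- x)"
proof -
  have lim: "((\<lambda>x. small_ball_fun M ((1 - \<epsilon>) * small_ball_inverse c a b x) / x - (1 - ln \<epsilon> / x))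
      \<longlongrightarrow> (1 - \<epsilon>) powr (- a) - (1 - 0)) at_top"
    using assms c a equiv
    by (intro tendsto_intros tendsto_small_ball_fun_inverse real_tendsto_divide_at_top[OF tendsto_const] filterlim_ident) auto
  have "0 < (1 - \<epsilon>) powr (- a) - (1 - 0)"
    using assms a powr_less_mono2[of a "1 - \<epsilon>" 1] by (simp add: powr_minus one_less_inverse_iff)
  from order_tendstoD(1)[OF lim this] eventually_gt_at_top[of 0]
  show ?thesis
  proof eventually_elim
    case (elim x)
    let ?m = "measure M (cball 0 ((1 - \<epsilon>) * small_ball_inverse c a b x))"
    show ?case
    \<comment> \<open>Mass zero is treated apart because of the default \<open>ln 0 = 0\<close>;
      there the claim is trivial.\<close>
    proof (cases "?m = 0")
      case False
      then have "?m > 0" by (simp add: zero_less_measure_iff)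
      have "x - ln \<epsilon> \<le> - ln ?m"
        using elim by (simp add: small_ball_fun_def field_simps)
      then have "ln ?m \<le> ln (\<epsilon> * exp (- x))" using assms by (simp add: ln_mult)
      then show ?thesis using \<open>?m > 0\<close> assms by simp
    qed (use assms in simp)
  qed
qed

text \<open>The ball whose radius is 1 + \<epsilon> times the asymptotic inverse is heavy enough to
  contain the one large cell. Finiteness is recorded too because \<open>enn2real\<close> sends
  infinity to 0.\<close>

lemma eventually_optimal_distortion_le:
  assumes "\<epsilon> > 0"
  shows "\<forall>\<^sub>F R in at_top. optimal_distortion M r \<alpha> R
    \<le> (1 + \<epsilon>) powr r * (small_ball_inverse c a b ((\<alpha> - 1) / \<alpha> * R) powr r * exp (- ((\<alpha> - 1) / \<alpha> * R)))"
    and eventually_INF_distortion_finite: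
    "\<forall>\<^sub>F R in at_top. (INF f\<in>{f \<in> quantizers. renyi_entropy M \<alpha> f \<le> R}. distortion M r f) < \<top>"
proof -
  have "filterlim (\<lambda>R. (\<alpha> - 1) / \<alpha> * R) at_top at_top"
    using \<alpha> by (intro filterlim_tendsto_pos_mult_at_top[OF tendsto_const] filterlim_ident) auto
  moreover have "\<forall>\<^sub>F x in at_top. x > 1 \<and> exp (- x) \<le> measure M (cball 0 ((1 + \<epsilon>) * small_ball_inverse c a b x))"
    by (intro eventually_conj eventually_gt_at_top eventually_small_ball_ge assms)
  ultimately have ev: "\<forall>\<^sub>F R in at_top. (\<alpha> - 1) / \<alpha> * R > 1 \<and> exp (- ((\<alpha> - 1) / \<alpha> * R))
      \<le> measure M (cball 0 ((1 + \<epsilon>) * small_ball_inverse c a b ((\<alpha> - 1) / \<alpha> * R)))"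
    by (rule eventually_compose_filterlim[rotated])
  have le: "(INF f\<in>{f \<in> quantizers. renyi_entropy M \<alpha> f \<le> R}. distortion M r f)
      \<le> ennreal (((1 + \<epsilon>) * small_ball_inverse c a b ((\<alpha> - 1) / \<alpha> * R)) powr r * exp (- ((\<alpha> - 1) / \<alpha> * R)))"
    if "(\<alpha> - 1) / \<alpha> * R > 1 \<and> exp (- ((\<alpha> - 1) / \<alpha> * R))
      \<le> measure M (cball 0 ((1 + \<epsilon>) * small_ball_inverse c a b ((\<alpha> - 1) / \<alpha> * R)))" for R
    using that M small_ball_inverse_pos[OF c a, of "(\<alpha> - 1) / \<alpha> * R" b] assms
    by (intro INF_distortion_le na r \<alpha>) (auto simp: centered_gaussian_def)
  show "\<forall>\<^sub>F R in at_top. optimal_distortion M r \<alpha> R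
    \<le> (1 + \<epsilon>) powr r * (small_ball_inverse c a b ((\<alpha> - 1) / \<alpha> * R) powr r * exp (- ((\<alpha> - 1) / \<alpha> * R)))"
    using ev
  proof eventually_elim
    case (elim R)
    show ?case
      unfolding optimal_distortion_def using le[OF elim] assms
        small_ball_inverse_pos[OF c a, of "(\<alpha> - 1) / \<alpha> * R" b] elim
      by (intro enn2real_leI) (auto simp: powr_mult mult.assoc)
  qed
  show "\<forall>\<^sub>F R in at_top. (INF f\<in>{f \<in> quantizers. renyi_entropy M \<alpha> f \<le> R}. distortion M r f) < \<top>"
    using ev by eventually_elim (rule le_less_trans[OF le], auto)
qed

text \<open>The factor (1 - \<epsilon>)^r comes from the shrunken radius, and the single factor 1 -
  \<epsilon> from the share of a cell that may lie within that radius of its quantization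
  point.\<close>

lemma eventually_optimal_distortion_ge:
  assumes \<epsilon>: "0 < \<epsilon>" "\<epsilon> < 1"
  shows "\<forall>\<^sub>F R in at_top. (1 - \<epsilon>) * (1 - \<epsilon>) powr r
    * (small_ball_inverse c a b ((\<alpha> - 1) / \<alpha> * R) powr r * exp (- ((\<alpha> - 1) / \<alpha> * R))) \<le> optimal_distortion M r \<alpha> R"
proof -
  define \<tau> where "\<tau> x = (1 - \<epsilon>) * small_ball_inverse c a b x" for x
  obtain X1 where X1: "\<And>x. x \<ge> X1 \<Longrightarrow> measure M (cball 0 (\<tau> x)) \<le> \<epsilon> * exp (- x)"
    using eventually_small_ball_le[OF \<epsilon>] by (auto simp: eventually_at_top_linorder \<tau>_def)
  obtain X2 where X2: "X2 > 1" "\<And>x y. x \<ge> X2 \<Longrightarrow> y \<ge> x \<Longrightarrow>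
      small_ball_inverse c a b x powr r * exp ((\<alpha> - 1) * x) \<le> small_ball_inverse c a b y powr r * exp ((\<alpha> - 1) * y)"
    using small_ball_inverse_exp_mono[OF c a r, of "\<alpha> - 1" b] \<alpha> by auto
  have "filterlim (\<lambda>R. (\<alpha> - 1) / \<alpha> * R) at_top at_top"
    using \<alpha> by (intro filterlim_tendsto_pos_mult_at_top[OF tendsto_const] filterlim_ident) auto
  then have "\<forall>\<^sub>F R in at_top. max X1 X2 \<le> (\<alpha> - 1) / \<alpha> * R"
    by (simp only: filterlim_at_top)
  \<comment> \<open>Monotonicity of \<open>enn2real\<close> calls for a finite infimum; the
    parameter 1 is an arbitrary positive choice.\<close>
  then show ?thesis using eventually_INF_distortion_finite[OF zero_less_one]
  proof eventually_elim
    case (elim R)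
    define \<rho> where "\<rho> = (\<alpha> - 1) / \<alpha> * R"
    have \<rho>: "\<rho> \<ge> X1" "\<rho> \<ge> X2" using elim by (auto simp: \<rho>_def)
    have pos: "small_ball_inverse c a b x > 0" if "x \<ge> \<rho>" for x
      using \<rho> X2(1) that by (intro small_ball_inverse_pos c a) auto
    have "ennreal ((1 - \<epsilon>) * \<tau> \<rho> powr r * exp (- \<rho>)) \<le> distortion M r f"
      if "f \<in> quantizers" "renyi_entropy M \<alpha> f \<le> R" for f
    proof (rule distortion_ge[OF M that(1) r \<alpha> that(2) \<rho>_def \<epsilon>])
      fix x assume x: "x \<ge> \<rho>"
      show "\<tau> x > 0" using pos[OF x] \<epsilon> by (simp add: \<tau>_def)
      show "measure M (cball 0 (\<tau> x)) \<le> \<epsilon> * exp (- x)" using X1 \<rho> x by simp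
      show "\<tau> \<rho> powr r * exp ((\<alpha> - 1) * \<rho>) \<le> \<tau> x powr r * exp ((\<alpha> - 1) * x)"
        using X2(2)[OF \<rho>(2) x] pos[OF x] pos[of \<rho>] \<epsilon> by (simp add: \<tau>_def powr_mult mult.assoc mult_left_mono)
    qed
    then have "ennreal ((1 - \<epsilon>) * \<tau> \<rho> powr r * exp (- \<rho>))
        \<le> (INF f\<in>{f \<in> quantizers. renyi_entropy M \<alpha> f \<le> R}. distortion M r f)"
      by (intro INF_greatest) auto
    then have "enn2real (ennreal ((1 - \<epsilon>) * \<tau> \<rho> powr r * exp (- \<rho>))) \<le> optimal_distortion M r \<alpha> R"
      unfolding optimal_distortion_def using elim(2) by (intro enn2real_mono)
    then show ?case
      using \<epsilon> pos[of \<rho>] by (simp add: \<tau>_def \<rho>_def powr_mult mult.assoc)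
  qed
qed

text \<open>For each \<epsilon> in (0, 1) the ratio eventually lies between (1 - \<epsilon>)(1 -
  \<epsilon>)^r and (1 + \<epsilon>)^r, and both bounds tend to 1 as \<epsilon> tends to 0.\<close>

lemma optimal_distortion_asymp_equiv:
  "optimal_distortion M r \<alpha> \<sim>[at_top]
    (\<lambda>R. small_ball_inverse c a b ((\<alpha> - 1) / \<alpha> * R) powr r * exp (- ((\<alpha> - 1) / \<alpha> * R)))"
proof (rule asymp_equivI')
  let ?g = "\<lambda>R. small_ball_inverse c a b ((\<alpha> - 1) / \<alpha> * R) powr r * exp (- ((\<alpha> - 1) / \<alpha> * R))"
  have "filterlim (\<lambda>R. (\<alpha> - 1) / \<alpha> * R) at_top at_top"
    using \<alpha> by (intro filterlim_tendsto_pos_mult_at_top[OF tendsto_const] filterlim_ident) auto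
  then have "\<forall>\<^sub>F R in at_top. 1 < (\<alpha> - 1) / \<alpha> * R"
    by (simp only: filterlim_at_top_dense)
  then have g: "\<forall>\<^sub>F R in at_top. 0 < ?g R"
  proof eventually_elim
    case (elim R)
    show ?case using small_ball_inverse_pos[OF c a elim, of b] by simp
  qed
  have unit: "\<forall>\<^sub>F \<epsilon> in at_right 0. 0 < \<epsilon> \<and> \<epsilon> < (1::real)"
    by (auto simp: eventually_at_right_field intro: exI[of _ 1])
  show "((\<lambda>R. optimal_distortion M r \<alpha> R / ?g R) \<longlongrightarrow> 1) at_top"
  proof (rule order_tendstoI)
    fix l :: real assume "l < 1"
    have "((\<lambda>\<epsilon>. (1 - \<epsilon>) * (1 - \<epsilon>) powr r) \<longlongrightarrow> (1 - 0) * (1 - 0) powr r) (at_right 0)"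
      by (intro tendsto_intros) auto
    then have ev: "\<forall>\<^sub>F \<epsilon> in at_right 0. l < (1 - \<epsilon>) * (1 - \<epsilon>) powr r"
      using \<open>l < 1\<close> by (intro order_tendstoD(1)) auto
    obtain \<epsilon> where \<epsilon>: "0 < \<epsilon>" "\<epsilon> < 1" "l < (1 - \<epsilon>) * (1 - \<epsilon>) powr r"
      using eventually_happens'[OF trivial_limit_at_right_real eventually_conj[OF ev unit]] by blast
    show "\<forall>\<^sub>F R in at_top. l < optimal_distortion M r \<alpha> R / ?g R"
      using eventually_optimal_distortion_ge[OF \<epsilon>(1,2)] g
    proof eventually_elim
      case (elim R)
      then have "(1 - \<epsilon>) * (1 - \<epsilon>) powr r \<le> optimal_distortion M r \<alpha> R / ?g R"
        by (simp only: pos_le_divide_eq)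
      with \<epsilon>(3) show ?case by (rule less_le_trans)
    qed
  next
    fix u :: real assume "1 < u"
    have "((\<lambda>\<epsilon>. (1 + \<epsilon>) powr r) \<longlongrightarrow> (1 + 0) powr r) (at_right 0)"
      by (intro tendsto_intros) auto
    then have ev: "\<forall>\<^sub>F \<epsilon> in at_right 0. (1 + \<epsilon>) powr r < u"
      using \<open>1 < u\<close> by (intro order_tendstoD(2)) auto
    obtain \<epsilon> where \<epsilon>: "0 < \<epsilon>" "(1 + \<epsilon>) powr r < u"
      using eventually_happens'[OF trivial_limit_at_right_real eventually_conj[OF ev unit]] by blast
    show "\<forall>\<^sub>F R in at_top. optimal_distortion M r \<alpha> R / ?g R < u"
      using eventually_optimal_distortion_le[OF \<epsilon>(1)] g
    proof eventually_elim
      case (elim R)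
      then have "optimal_distortion M r \<alpha> R / ?g R \<le> (1 + \<epsilon>) powr r"
        by (simp only: pos_divide_le_eq)
      then show ?case using \<epsilon>(2) by (rule le_less_trans)
    qed
  qed
qed

end

theorem corollary3p16:
  fixes M :: "'a::{banach, second_countable_topology} measure"
    and r \<alpha> c a b :: real
  assumes "\<nexists>B::'a set. finite B \<and> span B = UNIV"
    and "centered_gaussian M"
    and "non_atomic M"
    and "measure_support M = UNIV"
    and "r > 0" and "\<alpha> > 1" and "c > 0" and "a > 0"
    and "small_ball_fun M \<sim>[at_right 0] (\<lambda>s. c * (1 / s) powr a * ln (1 / s) powr b)"
  shows "optimal_distortion M r \<alpha> \<sim>[at_top]
    (\<lambda>R. (c powr (1 / a) * a powr (- b / a) * ((\<alpha> - 1) / \<alpha> * R) powr (- 1 / a)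
            * ln ((\<alpha> - 1) / \<alpha> * R) powr (b / a)) powr r
          * exp (- ((\<alpha> - 1) / \<alpha> * R)))"
  using optimal_distortion_asymp_equiv[OF assms(2,3,5-9)] by (simp only: small_ball_inverse_def)

end
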